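(* Let $\mu$ be a probability measure on a Polish space $\Omega$. Suppose that $\mu$ satisfies a matrix Poincaré inequality with constant $\alpha$ and matrix Markov generator $\mathcal{L}$, where $\mathcal{L}$ is reversible with respect to $\mu$; that is, $\mathrm{Var}_\mu(f)\preceq \alpha\,\mathcal{E}(f)$ for every $f:\Omega\to\mathcal{H}_d$ in $\mathcal{D}(\mathcal{L})$. Let $\Gamma$ be the associated matrix carré du champ operator, defined on an algebra $\mathcal{A}\subseteq\mathcal{D}(\mathcal{L})$. Then for any $f:\Omega\to\mathcal{H}_d$ in $\mathcal{A}$ and any $t\ge 0$, $$\mu\Big(\lambda_{\max}\big(f-\mathbb{E}_\mu f\big)\ge t\Big)\le d\,\exp\bigg(-\frac{t^2}{2\alpha v_f+t\sqrt{2\alpha v_f}}\bigg),$$ where $v_f=\big\|\,\|\Gamma(f)\|\,\big\|_{L_\infty}$.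
   Context: $\mathcal{H}_d$ is the set of $d\times d$ Hermitian matrices, $\preceq$ is the positive semi-definite order, $\|\cdot\|$ is the operator norm, $\lambda_{\max}$ is the largest eigenvalue, and $\|\cdot\|_{L_\infty}$ is the essential supremum over $\Omega$ with respect to $\mu$. Expectations $\mathbb{E}_\mu f=\int f\,d\mu$ of matrix-valued functions are taken entrywise, and for $f:\Omega\to\mathcal{H}_d$ with entries in $L^2(\mu)$, $\mathrm{Var}_\mu(f)=\mathbb{E}_\mu[f^2]-(\mathbb{E}_\mu f)^2$. Let $(X_t)_{t\ge0}$ be a Markov process on $\Omega$ with stationary measure $\mu$, with Markov semigroup $P_tf(x)=\mathbb{E}[f(X_t)\mid X_0=x]$ on $L^2(\mu)$ and infinitesimal generator $\mathcal{L}f=\lim_{t\to0}(P_tf-f)/t$ with $L^2(\mu)$-domain $\mathcal{D}(\mathcal{L})$. The process (or generator) is reversible with respect to $\mu$ if $\langle f,P_tg\rangle_\mu=\langle P_tf,g\rangle_\mu$ for all $f,g\in L^2(\mu)$ and $t\ge 0$. $P_t$ and $\mathcal{L}$ act on matrix-valued functions entrywise (then called matrix Markov semigroup and matrix Markov generator); a matrix-valued function is said to belong to $\mathcal{D}(\mathcal{L})$ (or to a subalgebra $\mathcal{A}$ of it) if all its entries do. The matrix Dirichlet form is $\mathcal{E}(f)=-\mathbb{E}_\mu[f\,\mathcal{L}(f)]$ for $f\in\mathcal{D}(\mathcal{L})$. Given an algebra $\mathcal{A}\subseteq\mathcal{D}(\mathcal{L})$, the matrix carré du champ operator is $\Gamma(f)=\frac12\big(\mathcal{L}(f^2)-f\mathcal{L}(f)-\mathcal{L}(f)f\big)$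 for $f\in\mathcal{A}$ (matrix products). *)

theory Defs
  imports "HOL-Probability.Probability" "HOL-Probability.Essential_Supremum"
begin

section \<open>Hermitian matrices\<close>

text \<open>
  A \<open>d \<times> d\<close> complex matrix has type \<open>complex^'n^'n\<close> with \<open>d = CARD('n)\<close>.  On this type \<open>*\<close> is the
  entrywise product and \<open>norm\<close> is the Frobenius norm, so the matrix product is always written \<open>**\<close>
  and the operator norm is taken with \<^const>\<open>onorm\<close> (the norm of \<open>complex^'n\<close> is Euclidean).
\<close>

definition adjoint_matrix :: "complex^'n^'n \<Rightarrow> complex^'n^'n" where
  "adjoint_matrix A = (\<chi> i j. cnj (A $ j $ i))"

definition hermitian :: "complex^'n^'n \<Rightarrow> bool" where
  "hermitian A \<longleftrightarrow> adjoint_matrix A = A"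

text \<open>The inner product \<open>\<bullet>\<close> of \<open>complex^'n\<close> is the real one, that is, the real part of the sesquilinear
  one; for Hermitian \<open>A\<close> the quadratic form is real, so nothing is lost.\<close>

definition psd :: "complex^'n^'n \<Rightarrow> bool" where
  "psd A \<longleftrightarrow> hermitian A \<and> (\<forall>x. 0 \<le> x \<bullet> (A *v x))"

definition psd_le :: "complex^'n^'n \<Rightarrow> complex^'n^'n \<Rightarrow> bool"  (infix "\<preceq>" 50) where
  "A \<preceq> B \<longleftrightarrow> psd (B - A)"

definition op_norm :: "complex^'n^'n \<Rightarrow> real" where
  "op_norm A = onorm (\<lambda>x. A *v x)"

text \<open>Only meant for Hermitian matrices, whose eigenvalues are all real.\<close>

definition lambda_max :: "complex^'n^'n \<Rightarrow> real" where
  "lambda_max A = Max {l. \<exists>x. x \<noteq> 0 \<and> A *v x = complex_of_real l *s x}"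


section \<open>Markov processes and their semigroups\<close>

definition events_upto :: "'w measure \<Rightarrow> (real \<Rightarrow> 'w \<Rightarrow> 'a::topological_space) \<Rightarrow> real \<Rightarrow> 'w set set" where
  "events_upto W X s =
     sigma_sets (space W) {X u -` B \<inter> space W | u B. 0 \<le> u \<and> u \<le> s \<and> B \<in> sets borel}"

text \<open>
  A time-homogeneous Markov process \<open>(X\<^sub>t)\<close>, \<open>t \<ge> 0\<close>, with state space \<open>'a\<close> on a measurable space
  \<open>W\<close> (of \<open>W\<close> only \<open>space\<close> and \<open>sets\<close> matter).  \<open>Pr x\<close> is the law on \<open>W\<close> conditional on
  \<open>X\<^sub>0 = x\<close>.  The last clause is the Markov property at time \<open>s\<close> with respect to the natural filtration.
\<close>

definition markov_process ::
    "'w measure \<Rightarrow> ('a::polish_space \<Rightarrow> 'w measure) \<Rightarrow> (real \<Rightarrow> 'w \<Rightarrow> 'a) \<Rightarrow> bool" where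
  "markov_process W Pr X \<longleftrightarrow>
     Pr \<in> borel \<rightarrow>\<^sub>M prob_algebra W \<and>
     (\<forall>t\<ge>0. X t \<in> W \<rightarrow>\<^sub>M borel) \<and>
     (\<forall>x. AE w in Pr x. X 0 w = x) \<and>
     (\<forall>x. \<forall>s\<ge>0. \<forall>t\<ge>0. \<forall>A \<in> events_upto W X s. \<forall>B \<in> sets borel.
        measure (Pr x) (A \<inter> {w \<in> space W. X (s + t) w \<in> B}) =
        (\<integral>w. indicator A w * measure (Pr (X s w)) {w' \<in> space W. X t w' \<in> B} \<partial>Pr x))"

definition stationary_measure ::
    "'a::polish_space measure \<Rightarrow> ('a \<Rightarrow> 'w measure) \<Rightarrow> (real \<Rightarrow> 'w \<Rightarrow> 'a) \<Rightarrow> bool" where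
  "stationary_measure \<mu> Pr X \<longleftrightarrow> (\<forall>t\<ge>0. \<mu> \<bind> (\<lambda>x. distr (Pr x) borel (X t)) = \<mu>)"

text \<open>\<open>P\<^sub>t f(x) = E[f(X\<^sub>t) | X\<^sub>0 = x]\<close>.  For \<open>f \<in> L\<^sup>2(\<mu>)\<close> the integral exists for \<open>\<mu>\<close>-almost every \<open>x\<close>.\<close>

definition markov_semigroup ::
    "('a \<Rightarrow> 'w measure) \<Rightarrow> (real \<Rightarrow> 'w \<Rightarrow> 'a) \<Rightarrow> real \<Rightarrow> ('a \<Rightarrow> complex) \<Rightarrow> 'a \<Rightarrow> complex" where
  "markov_semigroup Pr X t f x = (\<integral>w. f (X t w) \<partial>Pr x)"

text \<open>Elements of \<open>L\<^sup>2(\<mu>)\<close> are represented by functions, not by classes modulo null sets.\<close>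

definition L2 :: "'a measure \<Rightarrow> ('a \<Rightarrow> complex) set" where
  "L2 \<mu> = {f. f \<in> borel_measurable \<mu> \<and> integrable \<mu> (\<lambda>x. (cmod (f x))\<^sup>2)}"

definition inner_L2 :: "'a measure \<Rightarrow> ('a \<Rightarrow> complex) \<Rightarrow> ('a \<Rightarrow> complex) \<Rightarrow> complex" where
  "inner_L2 \<mu> f g = (\<integral>x. cnj (f x) * g x \<partial>\<mu>)"

definition reversible :: "'a measure \<Rightarrow> (real \<Rightarrow> ('a \<Rightarrow> complex) \<Rightarrow> 'a \<Rightarrow> complex) \<Rightarrow> bool" where
  "reversible \<mu> P \<longleftrightarrow>
     (\<forall>f \<in> L2 \<mu>. \<forall>g \<in> L2 \<mu>. \<forall>t\<ge>0. inner_L2 \<mu> f (P t g) = inner_L2 \<mu> (P t f) g)"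

definition generates ::
    "'a measure \<Rightarrow> (real \<Rightarrow> ('a \<Rightarrow> complex) \<Rightarrow> 'a \<Rightarrow> complex) \<Rightarrow> ('a \<Rightarrow> complex) \<Rightarrow> ('a \<Rightarrow> complex) \<Rightarrow> bool" where
  "generates \<mu> P f g \<longleftrightarrow> f \<in> L2 \<mu> \<and> g \<in> L2 \<mu> \<and>
     ((\<lambda>t. \<integral>x. (cmod ((P t f x - f x) / complex_of_real t - g x))\<^sup>2 \<partial>\<mu>) \<longlongrightarrow> 0) (at_right 0)"

definition gen_domain :: "'a measure \<Rightarrow> (real \<Rightarrow> ('a \<Rightarrow> complex) \<Rightarrow> 'a \<Rightarrow> complex) \<Rightarrow> ('a \<Rightarrow> complex) set" where
  "gen_domain \<mu> P = {f. \<exists>g. generates \<mu> P f g}"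

text \<open>On \<^const>\<open>gen_domain\<close> the choice is unique up to \<open>\<mu>\<close>-null sets.\<close>

definition generator ::
    "'a measure \<Rightarrow> (real \<Rightarrow> ('a \<Rightarrow> complex) \<Rightarrow> 'a \<Rightarrow> complex) \<Rightarrow> ('a \<Rightarrow> complex) \<Rightarrow> 'a \<Rightarrow> complex" where
  "generator \<mu> P f = (SOME g. generates \<mu> P f g)"

definition function_algebra :: "('a \<Rightarrow> complex) set \<Rightarrow> bool" where
  "function_algebra A \<longleftrightarrow> (\<lambda>x. 0) \<in> A \<and>
     (\<forall>f \<in> A. \<forall>g \<in> A. (\<lambda>x. f x + g x) \<in> A) \<and>
     (\<forall>c. \<forall>f \<in> A. (\<lambda>x. c * f x) \<in> A) \<and>
     (\<forall>f \<in> A. \<forall>g \<in> A. (\<lambda>x. f x * g x) \<in> A)"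


section \<open>Matrix-valued functions\<close>

definition entries_in :: "('a \<Rightarrow> complex^'n^'n) \<Rightarrow> ('a \<Rightarrow> complex) set \<Rightarrow> bool" where
  "entries_in F S \<longleftrightarrow> (\<forall>i j. (\<lambda>x. F x $ i $ j) \<in> S)"

definition mexpectation :: "'a measure \<Rightarrow> ('a \<Rightarrow> complex^'n^'n) \<Rightarrow> complex^'n^'n" where
  "mexpectation \<mu> F = (\<chi> i j. \<integral>x. F x $ i $ j \<partial>\<mu>)"

definition mvariance :: "'a measure \<Rightarrow> ('a \<Rightarrow> complex^'n^'n) \<Rightarrow> complex^'n^'n" where
  "mvariance \<mu> F = mexpectation \<mu> (\<lambda>x. F x ** F x) - mexpectation \<mu> F ** mexpectation \<mu> F"

definition mgenerator ::
    "'a measure \<Rightarrow> (real \<Rightarrow> ('a \<Rightarrow> complex) \<Rightarrow> 'a \<Rightarrow> complex) \<Rightarrow> ('a \<Rightarrow> complex^'n^'n) \<Rightarrow> 'a \<Rightarrow> complex^'n^'n" where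
  "mgenerator \<mu> P F x = (\<chi> i j. generator \<mu> P (\<lambda>y. F y $ i $ j) x)"

definition dirichlet_form ::
    "'a measure \<Rightarrow> (real \<Rightarrow> ('a \<Rightarrow> complex) \<Rightarrow> 'a \<Rightarrow> complex) \<Rightarrow> ('a \<Rightarrow> complex^'n^'n) \<Rightarrow> complex^'n^'n" where
  "dirichlet_form \<mu> P F = - mexpectation \<mu> (\<lambda>x. F x ** mgenerator \<mu> P F x)"

definition carre_du_champ ::
    "'a measure \<Rightarrow> (real \<Rightarrow> ('a \<Rightarrow> complex) \<Rightarrow> 'a \<Rightarrow> complex) \<Rightarrow> ('a \<Rightarrow> complex^'n^'n) \<Rightarrow> 'a \<Rightarrow> complex^'n^'n" where
  "carre_du_champ \<mu> P F x =
     (1 / 2) *\<^sub>R (mgenerator \<mu> P (\<lambda>y. F y ** F y) x - F x ** mgenerator \<mu> P F x - mgenerator \<mu> P F x ** F x)"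


section \<open>Extended real values\<close>

text \<open>
  The essential supremum of \<open>\<parallel>\<Gamma>(f)\<parallel>\<close> may be infinite and may vanish, so the tail bound is evaluated
  in \<^typ>\<open>ereal\<close>: there \<open>a / 0 = \<infinity>\<close> for \<open>a > 0\<close>, \<open>0 / 0 = 0\<close> and \<open>a / \<infinity> = 0\<close> for real \<open>a\<close>.
  (In \<^typ>\<open>real\<close>, \<open>a / 0 = 0\<close> would make the bound void when the essential supremum is \<open>0\<close>.)
\<close>

definition sqrt_ereal :: "ereal \<Rightarrow> ereal" where
  "sqrt_ereal x = (if \<bar>x\<bar> = \<infinity> then x else ereal (sqrt (real_of_ereal x)))"

definition exp_ereal :: "ereal \<Rightarrow> ereal" where
  "exp_ereal x = (if x = \<infinity> then \<infinity> else if x = -\<infinity> then 0 else ereal (exp (real_of_ereal x)))"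

definition esssup_op_norm :: "'a measure \<Rightarrow> ('a \<Rightarrow> complex^'n^'n) \<Rightarrow> ereal" where
  "esssup_op_norm \<mu> F = esssup \<mu> (\<lambda>x. ereal (op_norm (F x)))"

end

theory Submission
  imports Defs
begin

text \<open>
  Write \<open>g = f - \<E> f\<close> and \<open>w = \<alpha> v\<close>, and let \<open>E(h)\<close> be the trace of the Dirichlet form.  For Hermitian
  \<open>A, B\<close> the trace inequality
  \<open>2 tr (A\<^sup>k - B\<^sup>k)\<^sup>2 \<le> k\<^sup>2 tr (A - B)\<^sup>2 (A\<^sup>2\<^sup>k\<^sup>-\<^sup>2 + B\<^sup>2\<^sup>k\<^sup>-\<^sup>2)\<close>, averaged over the stationary pair \<open>(X\<^sub>0, X\<^sub>t)\<close> with
  \<open>t\<close> tending to \<open>0\<close>, gives \<open>E(g\<^sup>k) \<le> k\<^sup>2 v \<E> tr g\<^sup>2\<^sup>k\<^sup>-\<^sup>2\<close>.  Powers of \<open>g\<close> stay in the domain of the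
  generator because \<open>f\<close> lies in an algebra, so the Poincare inequality applies to them and bounds the
  even moments recursively, up to the terms \<open>tr (\<E> g\<^sup>k)\<^sup>2\<close>.  As \<open>\<E> g = 0\<close>, these are the traces of the products of
  \<open>\<E> g\<^sup>k\<close> with the covariance of \<open>g\<close> and \<open>g\<^sup>k\<^sup>-\<^sup>1\<close>, which Cauchy-Schwarz and \<open>\<E> g\<^sup>2 \<preceq> w I\<close> control without any loss in
  the dimension.  The result is Bernstein's moment condition \<open>\<E> tr g\<^sup>n \<le> d n! (w / 2)\<^sup>n\<^sup>/\<^sup>2\<close> for \<open>n \<ge> 2\<close>.
\<close>

section \<open>Hermitian matrices\<close>

text \<open>The generator may be of jump type, so there is no chain rule; the algebra need not
  contain exponentials; and \<open>f\<close> may be unbounded, so finiteness of exponential moments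
  is not known in advance. Polynomials avoid all three obstacles: their entries lie in the domain,
  hence in L2, and the trace inequality plays the part of the chain rule.

  The target dictates the constants. Moments bounded by d n! s^n, without a linear term, lead to the
  exponent (\<theta> s)^2 / (1 - \<theta> s) - \<theta> t, and s = sqrt (w / 2) is the value that
  produces the denominator 2 w + t sqrt (2 w). With this s the bound for n = 2 is w d, exactly what
  the Poincare inequality gives. So nothing may be lost at the second moment, and little at the
  third and fourth: this is why the mean of a power has to be treated with care and why n = 3 needs
  an argument of its own.\<close>

lemma inner_matrix: "A \<bullet> B = Re (\<Sum>i\<in>UNIV. \<Sum>j\<in>UNIV. cnj (A $ i $ j) * B $ i $ j)"
  for A B :: "complex^'n^'m"
  by (simp add: inner_vec_def inner_complex_def)

lemma inner_complex_vector: "x \<bullet> y = Re (\<Sum>i\<in>UNIV. cnj (x $ i) * y $ i)"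
  for x y :: "complex^'n"
  by (simp add: inner_vec_def inner_complex_def)

lemma of_real_smult: "complex_of_real l *s x = l *\<^sub>R x" for x :: "complex^'n"
  by (simp add: vec_eq_iff complex_eq_iff)

lemma adjoint_matrix_nth: "adjoint_matrix A $ i $ j = cnj (A $ j $ i)"
  by (simp add: adjoint_matrix_def)

lemma adjoint_matrix_mult: "adjoint_matrix (A ** B) = adjoint_matrix B ** adjoint_matrix A"
  by (simp add: vec_eq_iff adjoint_matrix_nth matrix_matrix_mult_def mult.commute)

lemma hermitian_nth: "hermitian A \<Longrightarrow> cnj (A $ i $ j) = A $ j $ i"
  by (metis adjoint_matrix_nth hermitian_def)

lemma hermitian_mat_1 [simp]: "hermitian (mat 1)"
  by (auto simp: hermitian_def vec_eq_iff adjoint_matrix_nth mat_def)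

lemma hermitian_diff: "hermitian A \<Longrightarrow> hermitian B \<Longrightarrow> hermitian (A - B)"
  by (simp add: hermitian_def vec_eq_iff adjoint_matrix_nth)

text \<open>\<open>A \<bullet> B\<close> is the real part of the trace of the adjoint of
  \<open>A\<close> times \<open>B\<close>, so moving a factor across it is cyclicity of the trace.
  The trace identities below are phrased in this way.\<close>

lemma inner_mult_adjoint: "(A ** B) \<bullet> C = B \<bullet> (adjoint_matrix A ** C)" for A B C :: "complex^'n^'n"
proof -
  have "(A ** B) \<bullet> C = Re (\<Sum>i\<in>UNIV. \<Sum>j\<in>UNIV. \<Sum>k\<in>UNIV. cnj (A $ i $ k) * cnj (B $ k $ j) * C $ i $ j)"
    unfolding inner_matrix by (simp add: matrix_matrix_mult_def sum_distrib_right)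
  also have "\<dots> = Re (\<Sum>k\<in>UNIV. \<Sum>j\<in>UNIV. \<Sum>i\<in>UNIV. cnj (A $ i $ k) * cnj (B $ k $ j) * C $ i $ j)"
    by (subst sum.swap, subst (2) sum.swap, subst sum.swap) (rule refl)
  also have "\<dots> = B \<bullet> (adjoint_matrix A ** C)"
    unfolding inner_matrix
    by (simp add: matrix_matrix_mult_def sum_distrib_left adjoint_matrix_nth mult_ac)
  finally show ?thesis .
qed

lemma inner_adjoint: "adjoint_matrix A \<bullet> adjoint_matrix B = A \<bullet> B" for A B :: "complex^'n^'n"
  unfolding inner_matrix by (subst sum.swap) (simp add: adjoint_matrix_nth mult.commute)

lemma inner_mult_hermitian_left:
  "hermitian H \<Longrightarrow> (H ** A) \<bullet> B = A \<bullet> (H ** B)" for H A B :: "complex^'n^'n"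
  by (simp add: inner_mult_adjoint hermitian_def)

lemma inner_mult_hermitian_right:
  fixes H A B :: "complex^'n^'n"
  assumes "hermitian H"
  shows "(A ** H) \<bullet> B = A \<bullet> (B ** H)"
proof -
  have "(A ** H) \<bullet> B = (H ** adjoint_matrix A) \<bullet> adjoint_matrix B"
    using assms inner_adjoint[of "A ** H" B] by (simp add: adjoint_matrix_mult hermitian_def)
  also have "\<dots> = adjoint_matrix A \<bullet> adjoint_matrix (B ** H)"
    using assms by (simp add: inner_mult_hermitian_left adjoint_matrix_mult hermitian_def)
  finally show ?thesis by (simp add: inner_adjoint)
qed

lemma Re_trace_mult_hermitian: "hermitian A \<Longrightarrow> Re (trace (A ** B)) = A \<bullet> B"
  for A B :: "complex^'n^'n"
  unfolding inner_matrix trace_def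
  by (subst sum.swap) (simp add: matrix_matrix_mult_def hermitian_nth)

lemma matrix_diff_ldistrib: "A ** (B - C) = A ** B - A ** C" for A B C :: "complex^'n^'n"
  by (simp add: vec_eq_iff matrix_matrix_mult_def right_diff_distrib sum_subtractf)

lemma matrix_diff_rdistrib: "(A - B) ** C = A ** C - B ** C" for A B C :: "complex^'n^'n"
  by (simp add: vec_eq_iff matrix_matrix_mult_def left_diff_distrib sum_subtractf)

lemma matrix_mult_sum_right: "A ** (\<Sum>i\<in>I. F i) = (\<Sum>i\<in>I. A ** F i)"
  for A :: "complex^'n^'n"
  by (induction I rule: infinite_finite_induct) (simp_all add: matrix_add_ldistrib)

section \<open>Powers of Hermitian matrices and the trace inequality for their differences\<close>

primrec matpow :: "complex^'n^'n \<Rightarrow> nat \<Rightarrow> complex^'n^'n" where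
  "matpow A 0 = mat 1"
| "matpow A (Suc k) = A ** matpow A k"

lemma matpow_1 [simp]: "matpow A (Suc 0) = A"
  by simp

lemma matpow_add: "matpow A (i + j) = matpow A i ** matpow A j"
  by (induction i) (simp_all add: matrix_mul_assoc)

lemma matpow_mult_commute: "matpow A k ** A = A ** matpow A k"
  using matpow_add[of A k 1] by simp

lemma hermitian_matpow: "hermitian A \<Longrightarrow> hermitian (matpow A k)"
  by (induction k) (simp_all add: hermitian_def adjoint_matrix_mult matpow_mult_commute
      hermitian_mat_1[unfolded hermitian_def])

lemma inner_matpow_shift:
  assumes "hermitian A"
  shows "matpow A (i + k) \<bullet> matpow A j = matpow A i \<bullet> matpow A (k + j)"
  by (metis add.commute assms hermitian_matpow inner_mult_hermitian_left matpow_add)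

lemma inner_matpow_eq:
  assumes "hermitian A" "i + j = k + l"
  shows "matpow A i \<bullet> matpow A j = matpow A k \<bullet> matpow A l"
proof -
  have "matpow A i \<bullet> matpow A j = matpow A 0 \<bullet> matpow A (i + j)" for i j
    using inner_matpow_shift[OF assms(1), of 0 i j] by simp
  then show ?thesis by (metis assms(2))
qed

lemma matpow_diff_telescope:
  "matpow A (Suc n) - matpow B (Suc n) = (\<Sum>i\<le>n. matpow A i ** (A - B) ** matpow B (n - i))"
proof (induction n)
  case 0
  show ?case by simp
next
  case (Suc n)
  have "matpow A (Suc (Suc n)) - matpow B (Suc (Suc n)) =
      A ** (matpow A (Suc n) - matpow B (Suc n)) + (A - B) ** matpow B (Suc n)"
    by (simp add: matrix_diff_ldistrib matrix_diff_rdistrib)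
  also have "\<dots> = (\<Sum>i\<le>n. matpow A (Suc i) ** (A - B) ** matpow B (n - i)) + (A - B) ** matpow B (Suc n)"
    unfolding Suc.IH matrix_mult_sum_right by (simp add: matrix_mul_assoc)
  also have "\<dots> = (\<Sum>i\<le>Suc n. matpow A i ** (A - B) ** matpow B (Suc n - i))"
    by (subst sum.atMost_Suc_shift) (simp add: add.commute)
  finally show ?case .
qed

text \<open>Discrete Hermite-Hadamard: the increments of a convex sequence grow, so
  \<open>c i + c (n - i)\<close> can only decrease as i moves from the end to the middle. Pairing i
  with n - i gives the trapezoid bound.\<close>

lemma sum_convex_le:
  fixes c :: "nat \<Rightarrow> real"
  assumes "\<And>i. 0 < i \<Longrightarrow> i < n \<Longrightarrow> 2 * c i \<le> c (i - 1) + c (i + 1)"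
  shows "2 * (\<Sum>i\<le>n. c i) \<le> real (n + 1) * (c 0 + c n)"
proof -
  have mono: "c (Suc i) - c i \<le> c (Suc j) - c j" if "i \<le> j" "j < n" for i j
    using that
  proof (induction j rule: dec_induct)
    case (step m)
    have "2 * c (Suc m) \<le> c m + c (Suc (Suc m))"
      using assms[of "Suc m"] step by simp
    with step show ?case by simp
  qed simp
  have low: "c i + c (n - i) \<le> c 0 + c n" if "2 * i \<le> n" for i
    using that
  proof (induction i)
    case (Suc i)
    have "c (Suc i) - c i \<le> c (Suc (n - Suc i)) - c (n - Suc i)"
      using Suc.prems by (intro mono) auto
    moreover have "Suc (n - Suc i) = n - i" using Suc.prems by simp
    ultimately show ?case using Suc by simp
  qed simp
  have pair: "c i + c (n - i) \<le> c 0 + c n" if "i \<le> n" for i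
  proof (cases "2 * i \<le> n")
    case False
    then have "2 * (n - i) \<le> n" "n - (n - i) = i" using that by auto
    with low[of "n - i"] show ?thesis by simp
  qed (rule low)
  have "2 * (\<Sum>i\<le>n. c i) = (\<Sum>i\<le>n. c i + c (n - i))"
    by (simp add: sum.distrib atMost_atLeast0 sum.atLeastAtMost_rev[of c 0 n])
  also have "\<dots> \<le> (\<Sum>i\<le>n. c 0 + c n)"
    by (intro sum_mono pair) simp
  finally show ?thesis by (simp add: algebra_simps)
qed

text \<open>By Cauchy-Schwarz the norms of \<open>A\<^sup>i (A - B) B\<^sup>n\<^sup>-\<^sup>i\<close> are log-convex in \<open>i\<close>, so the two extreme ones bound their sum.\<close>

lemma norm_matpow_diff_le:
  assumes "hermitian A" "hermitian B"
  shows "2 * (norm (matpow A (Suc n) - matpow B (Suc n)))\<^sup>2 \<le>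
    (real (Suc n))\<^sup>2 * ((norm ((A - B) ** matpow A n))\<^sup>2 + (norm ((A - B) ** matpow B n))\<^sup>2)"
proof -
  define c where "c i = norm (matpow A i ** (A - B) ** matpow B (n - i))" for i
  have D: "hermitian (A - B)" using assms by (rule hermitian_diff)
  have conv: "2 * c i \<le> c (i - 1) + c (i + 1)" if i: "0 < i" "i < n" for i
  proof -
    obtain j where j: "i = Suc j" using i by (cases i) auto
    obtain l where l: "n - i = Suc l" using i by (cases "n - i") auto
    let ?X = "matpow A (i - 1) ** (A - B) ** matpow B (n - (i - 1))"
    let ?Y = "matpow A (i + 1) ** (A - B) ** matpow B (n - (i + 1))"
    have idx: "n - (i - 1) = Suc (Suc l)" "n - (i + 1) = l" "n - j = Suc (Suc l)" "n - Suc (Suc j) = l" "i - 1 = j" "i + 1 = Suc (Suc j)"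
      using i j l by auto
    \<comment> \<open>One factor \<open>A\<close> moves from the left argument to the right and one
      factor \<open>B\<close> the other way; this turns the square into the inner product of the two
      neighbouring terms.\<close>
    have "(c i)\<^sup>2 = (A ** (matpow A j ** (A - B) ** matpow B l) ** B) \<bullet> (A ** (matpow A j ** (A - B) ** matpow B l) ** B)"
      unfolding c_def l power2_norm_eq_inner by (simp add: j matrix_mul_assoc flip: matpow_mult_commute)
    also have "\<dots> = ((matpow A j ** (A - B) ** matpow B l) ** B) \<bullet> (A ** (A ** (matpow A j ** (A - B) ** matpow B l) ** B))"
      by (subst inner_mult_hermitian_left[OF assms(1), symmetric]) (simp add: matrix_mul_assoc)
    also have "\<dots> = ((matpow A j ** (A - B) ** matpow B l) ** B ** B) \<bullet> (A ** (A ** (matpow A j ** (A - B) ** matpow B l)))"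
      by (subst inner_mult_hermitian_right[OF assms(2)]) (simp add: matrix_mul_assoc)
    also have "\<dots> = ?X \<bullet> ?Y"
      unfolding idx by (simp add: matrix_mul_assoc flip: matpow_mult_commute)
    also have "\<dots> \<le> c (i - 1) * c (i + 1)"
      unfolding c_def by (rule norm_cauchy_schwarz)
    finally have "(2 * c i)\<^sup>2 \<le> 4 * (c (i - 1) * c (i + 1))" by (simp add: power_mult_distrib)
    also have "\<dots> \<le> (c (i - 1) + c (i + 1))\<^sup>2"
      using sum_squares_ge_zero[of "c (i - 1) - c (i + 1)" 0] by (simp add: power2_eq_square algebra_simps)
    finally show ?thesis
      by (rule power2_le_imp_le) (simp add: c_def)
  qed
  have "norm (matpow A (Suc n) - matpow B (Suc n)) \<le> (\<Sum>i\<le>n. c i)"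
    unfolding matpow_diff_telescope c_def by (rule norm_sum)
  with sum_convex_le[OF conv, of n]
  have "2 * norm (matpow A (Suc n) - matpow B (Suc n)) \<le> real (Suc n) * (c 0 + c n)"
    by simp
  then have "(2 * norm (matpow A (Suc n) - matpow B (Suc n)))\<^sup>2 \<le> (real (Suc n) * (c 0 + c n))\<^sup>2"
    by (rule power_mono) simp
  also have "\<dots> \<le> (real (Suc n))\<^sup>2 * (2 * ((c 0)\<^sup>2 + (c n)\<^sup>2))"
    unfolding power_mult_distrib
    by (intro mult_left_mono) (use sum_squares_ge_zero[of "c 0 - c n" 0] in \<open>simp_all add: power2_eq_square algebra_simps\<close>)
  \<comment> \<open>Taking adjoints reverses the product and preserves the Frobenius norm.\<close>
  also have "c n = norm ((A - B) ** matpow A n)"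
    unfolding c_def norm_eq_sqrt_inner
    using inner_adjoint[of "matpow A n ** (A - B)" "matpow A n ** (A - B)"] hermitian_matpow[OF assms(1), of n] D
    by (simp add: adjoint_matrix_mult hermitian_def)
  finally show ?thesis by (simp add: c_def power_mult_distrib algebra_simps)
qed

text \<open>The two mixed terms pair one power of \<open>A\<close> with one power of
  \<open>B\<close>. In this form the square can be averaged over two times of the process, as the
  semigroup then acts on a single power.\<close>

lemma norm_diff_mult_matpow:
  assumes "hermitian A" "hermitian B"
  shows "(norm ((A - B) ** matpow A n))\<^sup>2 =
    matpow A (2 * n) \<bullet> matpow B 2 - 2 * (matpow A (2 * n + 1) \<bullet> B) + (norm (matpow A (n + 1)))\<^sup>2"
proof -
  have A: "hermitian (matpow A k)" for k by (rule hermitian_matpow) fact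
  have BB: "(B ** matpow A n) \<bullet> (B ** matpow A n) = matpow A (2 * n) \<bullet> matpow B 2"
    by (subst inner_mult_hermitian_left[OF assms(2)], subst inner_commute,
        subst matrix_mul_assoc, subst inner_mult_hermitian_right[OF A, symmetric])
      (simp add: numeral_2_eq_2 matpow_add inner_mult_hermitian_right[OF A] inner_commute mult_2)
  have AB: "matpow A (n + 1) \<bullet> (B ** matpow A n) = matpow A (2 * n + 1) \<bullet> B"
    by (subst inner_mult_hermitian_right[OF A, symmetric]) (simp add: mult_2 matpow_add[symmetric] matrix_mul_assoc[symmetric])
  have "(norm ((A - B) ** matpow A n))\<^sup>2 = (matpow A (n + 1) - B ** matpow A n) \<bullet> (matpow A (n + 1) - B ** matpow A n)"
    by (simp add: power2_norm_eq_inner matrix_diff_rdistrib)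
  also have "\<dots> = (norm (matpow A (n + 1)))\<^sup>2 - 2 * (matpow A (n + 1) \<bullet> (B ** matpow A n)) + (B ** matpow A n) \<bullet> (B ** matpow A n)"
    by (simp only: inner_diff_left inner_diff_right power2_norm_eq_inner inner_commute[of "B ** matpow A n" "matpow A (n + 1)"])
  finally show ?thesis unfolding AB BB by simp
qed

section \<open>Operator norm and quadratic forms\<close>

lemma norm_matrix_vector_mult_le: "norm (A *v x) \<le> norm A * norm x" for A :: "complex^'n^'m"
proof -
  have "norm ((A *v x) $ i) \<le> norm (A $ i) * norm x" for i
  proof -
    have "norm ((A *v x) $ i) \<le> (\<Sum>j\<in>UNIV. \<bar>norm (A $ i $ j)\<bar> * \<bar>norm (x $ j)\<bar>)"
      unfolding matrix_vector_mult_def by (simp add: norm_mult[symmetric] norm_sum)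
    also have "\<dots> \<le> norm (A $ i) * norm x"
      unfolding norm_vec_def by (rule L2_set_mult_ineq)
    finally show ?thesis .
  qed
  then have "norm (A *v x) \<le> L2_set (\<lambda>i. norm (A $ i) * norm x) UNIV"
    unfolding norm_vec_def[of "A *v x"] by (intro L2_set_mono) auto
  then show ?thesis
    by (simp add: L2_set_left_distrib norm_vec_def[of A])
qed

lemma norm_matrix_vector_mult_le_op_norm: "norm (A *v x) \<le> op_norm A * norm x"
  unfolding op_norm_def by (rule onorm) simp

lemma op_norm_nonneg: "0 \<le> op_norm A"
  unfolding op_norm_def by (rule onorm_pos_le) simp

text \<open>The Frobenius inner product is the sum over the columns, so a bound on the quadratic
  form of \<open>C\<close> carries over to matrices without a factor d.\<close>

lemma inner_mult_le_columns:
  fixes C N :: "complex^'n^'n"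
  assumes "\<And>x. x \<bullet> (C *v x) \<le> c * (norm x)\<^sup>2"
  shows "N \<bullet> (C ** N) \<le> c * (norm N)\<^sup>2"
proof -
  have col: "A \<bullet> B = (\<Sum>j\<in>UNIV. column j A \<bullet> column j B)" for A B :: "complex^'n^'n"
    unfolding inner_vec_def column_def by (subst sum.swap) simp
  have "column j (C ** N) = C *v column j N" for j
    by (simp add: vec_eq_iff column_def matrix_matrix_mult_def matrix_vector_mult_def)
  then have "N \<bullet> (C ** N) = (\<Sum>j\<in>UNIV. column j N \<bullet> (C *v column j N))"
    by (simp add: col)
  also have "\<dots> \<le> (\<Sum>j\<in>UNIV. c * (norm (column j N))\<^sup>2)"
    by (intro sum_mono assms)
  also have "\<dots> = c * (norm N)\<^sup>2"
    by (simp add: power2_norm_eq_inner col sum_distrib_left)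
  finally show ?thesis .
qed

lemma Re_trace_psd_nonneg: "psd A \<Longrightarrow> 0 \<le> Re (trace A)"
proof -
  assume "psd A"
  then have "0 \<le> axis i 1 \<bullet> (A *v axis i 1)" for i
    by (simp add: psd_def)
  moreover have "axis i 1 \<bullet> (A *v axis i 1) = Re (A $ i $ i)" for i
    by (simp add: inner_axis' inner_complex_def matrix_vector_mult_def)
      (simp add: axis_def if_distrib[of Re] if_distrib[of Im] if_distrib[of "(*) _"] cong: if_cong)
  ultimately show ?thesis
    by (simp add: trace_def sum_nonneg)
qed

section \<open>Real eigenvalues of Hermitian matrices\<close>

lemma inner_matrix_vector_hermitian:
  fixes A :: "complex^'n^'n"
  assumes "hermitian A"
  shows "(A *v x) \<bullet> y = x \<bullet> (A *v y)"
proof -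
  have "(A *v x) \<bullet> y = Re (\<Sum>i\<in>UNIV. \<Sum>j\<in>UNIV. cnj (A $ i $ j) * cnj (x $ j) * y $ i)"
    by (simp add: inner_complex_vector matrix_vector_mult_def sum_distrib_right)
  also have "\<dots> = Re (\<Sum>j\<in>UNIV. \<Sum>i\<in>UNIV. cnj (A $ i $ j) * cnj (x $ j) * y $ i)"
    by (subst sum.swap) (rule refl)
  also have "\<dots> = x \<bullet> (A *v y)"
    using assms
    by (simp add: inner_complex_vector matrix_vector_mult_def sum_distrib_left hermitian_nth mult_ac)
  finally show ?thesis .
qed

text \<open>Eigenvectors for distinct eigenvalues are orthogonal, hence independent. Finiteness
  gives \<open>Max\<close> in \<open>lambda_max\<close> its meaning.\<close>

lemma eigenvalue_set_finite:
  fixes A :: "complex^'n^'n"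
  assumes "hermitian A"
  shows "finite {l. \<exists>x. x \<noteq> 0 \<and> A *v x = complex_of_real l *s x}" (is "finite ?E")
proof -
  define e where "e l = (SOME x. x \<noteq> 0 \<and> A *v x = complex_of_real l *s x)" for l
  have e: "e l \<noteq> 0 \<and> A *v e l = complex_of_real l *s e l" if "l \<in> ?E" for l
    unfolding e_def by (rule someI_ex) (use that in simp)
  have orth: "e l \<bullet> e m = 0" if "l \<in> ?E" "m \<in> ?E" "l \<noteq> m" for l m
    using inner_matrix_vector_hermitian[OF assms, of "e l" "e m"] e[OF that(1)] e[OF that(2)] that(3)
    by (simp add: of_real_smult)
  have inj: "inj_on e ?E"
  proof (rule inj_onI, rule ccontr)
    fix l m assume lm: "l \<in> ?E" "m \<in> ?E" "e l = e m" "l \<noteq> m"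
    then show False using orth[OF lm(1,2,4)] e[OF lm(1)] by simp
  qed
  have "orthogonal (e l) (e m)" if "l \<in> ?E" "m \<in> ?E" "e l \<noteq> e m" for l m
    unfolding orthogonal_def using that by (intro orth) auto
  then have "pairwise orthogonal (e ` ?E)"
    by (intro pairwiseI) (erule imageE, erule imageE, simp only:)
  moreover have "0 \<notin> e ` ?E"
  proof
    assume "0 \<in> e ` ?E"
    then obtain l where "0 = e l" "l \<in> ?E" by (rule imageE)
    then show False using e[of l] by simp
  qed
  ultimately have "independent (e ` ?E)"
    by (rule pairwise_orthogonal_independent)
  then have "finite (e ` ?E)"
    using independent_bound by blast
  then show ?thesis
    using inj by (rule finite_imageD)
qed

text \<open>First-order condition: the polynomial attains its minimum 0 at r = 0.\<close>

lemma quadratic_nonneg_imp_linear_coeff_0: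
  fixes a b :: real
  assumes nonneg: "\<And>r. 0 \<le> 2 * r * a + r\<^sup>2 * b"
  shows "a = 0"
proof -
  \<comment> \<open>This size keeps \<open>b - 2 * c\<close> negative whatever the sign of
    b.\<close>
  define c where "c = \<bar>b\<bar> + 1"
  have c: "c > 0" "b - 2 * c < 0" by (auto simp: c_def)
  have "0 \<le> c\<^sup>2 * (2 * (- a / c) * a + (- a / c)\<^sup>2 * b)"
    by (rule mult_nonneg_nonneg[OF _ nonneg]) simp
  also have "\<dots> = a\<^sup>2 * (b - 2 * c)"
    using c(1) by (simp add: power2_eq_square field_simps)
  finally show ?thesis
    using c(2) by (simp add: zero_le_mult_iff)
qed

text \<open>A maximiser of the Rayleigh quotient is an eigenvector.\<close>

lemma eigenvalue_exists:
  fixes A :: "complex^'n^'n"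
  assumes "hermitian A"
  shows "\<exists>l x. x \<noteq> 0 \<and> A *v x = complex_of_real l *s x"
proof -
  have "axis undefined 1 \<in> sphere (0 :: complex^'n) 1"
    by (simp add: norm_eq_sqrt_inner inner_axis_axis)
  then have ne: "sphere (0 :: complex^'n) 1 \<noteq> {}" by blast
  have "continuous_on (sphere 0 1) (\<lambda>y. y \<bullet> (A *v y))"
    by (intro continuous_intros linear_continuous_on) simp
  from continuous_attains_sup[OF compact_sphere ne this]
  obtain u where u: "norm u = 1" and max: "\<And>y. norm y = 1 \<Longrightarrow> y \<bullet> (A *v y) \<le> u \<bullet> (A *v u)"
    by auto
  define l where "l = u \<bullet> (A *v u)"
  \<comment> \<open>The form of \<open>S\<close> is nonnegative and vanishes at the maximiser u.
    Perturbing u in the direction p = S u then forces p = 0.\<close>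
  define S where "S y = l *\<^sub>R y - A *v y" for y
  have S_pos: "0 \<le> y \<bullet> S y" for y
  proof (cases "y = 0")
    case False
    let ?z = "inverse (norm y) *\<^sub>R y"
    have "?z \<bullet> (A *v ?z) \<le> l"
      unfolding l_def using False by (intro max) simp
    then have "(y \<bullet> (A *v y)) / (norm y)\<^sup>2 \<le> l"
      by (simp add: linear_cmul[OF matrix_vector_mul_linear] power2_eq_square divide_inverse mult_ac)
    then have "y \<bullet> (A *v y) \<le> l * (norm y)\<^sup>2"
      using False by (simp add: pos_divide_le_eq)
    then show ?thesis
      by (simp add: S_def inner_diff_right power2_norm_eq_inner)
  qed (simp add: S_def)
  have S_u: "u \<bullet> S u = 0"
    using u by (simp add: S_def inner_diff_right l_def dot_square_norm)
  have S_sym: "S x \<bullet> y = x \<bullet> S y" for x y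
    by (simp add: S_def inner_diff_right inner_diff_left inner_matrix_vector_hermitian[OF assms])
  have S_lin: "linear S"
    unfolding S_def by (intro linear_compose_sub linear_scale_self matrix_vector_mul_linear)
  define p where "p = S u"
  have uSp: "u \<bullet> S p = (norm p)\<^sup>2"
    using S_sym[of u p] by (simp add: p_def power2_norm_eq_inner)
  have quad: "0 \<le> 2 * r * (norm p)\<^sup>2 + r\<^sup>2 * (p \<bullet> S p)" for r
  proof -
    have "(u + r *\<^sub>R p) \<bullet> S (u + r *\<^sub>R p) = 2 * r * (norm p)\<^sup>2 + r\<^sup>2 * (p \<bullet> S p)"
      using S_u uSp unfolding p_def[symmetric]
      by (simp add: linear_add[OF S_lin] linear_cmul[OF S_lin] inner_add_left inner_add_right
          p_def[symmetric] dot_square_norm power2_eq_square algebra_simps)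
    then show ?thesis by (metis S_pos)
  qed
  have "(norm p)\<^sup>2 = 0"
    by (rule quadratic_nonneg_imp_linear_coeff_0[OF quad])
  then have "p = 0" by simp
  then have "A *v u = complex_of_real l *s u"
    by (simp add: p_def S_def of_real_smult)
  moreover have "u \<noteq> 0" using u by auto
  ultimately show ?thesis by blast
qed

lemma lambda_max_eigenvector:
  fixes A :: "complex^'n^'n"
  assumes "hermitian A"
  obtains x where "x \<noteq> 0" "A *v x = complex_of_real (lambda_max A) *s x"
proof -
  let ?E = "{l. \<exists>x. x \<noteq> 0 \<and> A *v x = complex_of_real l *s x}"
  have "?E \<noteq> {}" using eigenvalue_exists[OF assms] by simp
  then have "Max ?E \<in> ?E" by (rule Max_in[OF eigenvalue_set_finite[OF assms]])
  then show ?thesis using that unfolding lambda_max_def by auto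
qed

text \<open>An eigenvector of \<open>A\<close> is one of every polynomial in \<open>A\<close>, and
  the Frobenius norm dominates each eigenvalue. This leads from \<open>lambda_max\<close> to trace
  moments without diagonalising \<open>A\<close>.\<close>

lemma abs_polynomial_eigenvalue_le_norm:
  fixes A :: "complex^'n^'n"
  assumes "x \<noteq> 0" "A *v x = complex_of_real l *s x"
  shows "\<bar>\<Sum>k\<in>I. c k * l ^ k\<bar> \<le> norm (\<Sum>k\<in>I. c k *\<^sub>R matpow A k)"
proof -
  have pow: "matpow A k *v x = l ^ k *\<^sub>R x" for k
  proof (induction k)
    case (Suc k)
    have "matpow A (Suc k) *v x = A *v (matpow A k *v x)" by (simp add: matrix_vector_mul_assoc)
    also have "\<dots> = l ^ k *\<^sub>R (A *v x)" by (simp add: Suc linear_cmul[OF matrix_vector_mul_linear])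
    also have "\<dots> = l ^ Suc k *\<^sub>R x"
      unfolding assms(2) by (simp add: of_real_smult)
    finally show ?case .
  qed simp
  have smult: "(a *\<^sub>R B) *v x = a *\<^sub>R (B *v x)" for a and B :: "complex^'n^'n"
    by (simp add: vec_eq_iff matrix_vector_mult_def flip: scaleR_sum_right)
  have "(\<Sum>k\<in>I. c k *\<^sub>R matpow A k) *v x = (\<Sum>k\<in>I. c k * l ^ k) *\<^sub>R x"
    by (induction I rule: infinite_finite_induct)
      (simp_all add: matrix_vector_mult_add_rdistrib smult pow scaleR_add_left)
  then have "\<bar>\<Sum>k\<in>I. c k * l ^ k\<bar> * norm x \<le> norm (\<Sum>k\<in>I. c k *\<^sub>R matpow A k) * norm x"
    using norm_matrix_vector_mult_le[of "\<Sum>k\<in>I. c k *\<^sub>R matpow A k" x] by simp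
  then show ?thesis using assms(1) by simp
qed

section \<open>Reversible Markov kernels\<close>

lemma integral_Cauchy_Schwarz:
  fixes u v :: "'a \<Rightarrow> real"
  assumes [measurable]: "u \<in> borel_measurable M" "v \<in> borel_measurable M"
    and u2: "integrable M (\<lambda>x. (u x)\<^sup>2)" and v2: "integrable M (\<lambda>x. (v x)\<^sup>2)"
  shows "integrable M (\<lambda>x. u x * v x)"
    and "(\<integral>x. u x * v x \<partial>M)\<^sup>2 \<le> (\<integral>x. (u x)\<^sup>2 \<partial>M) * (\<integral>x. (v x)\<^sup>2 \<partial>M)"
proof -
  show uv: "integrable M (\<lambda>x. u x * v x)"
  proof (rule Bochner_Integration.integrable_bound)
    show "integrable M (\<lambda>x. (u x)\<^sup>2 + (v x)\<^sup>2)" using u2 v2 by simp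
    have "\<bar>a * b\<bar> \<le> a\<^sup>2 + b\<^sup>2" for a b :: real
    proof -
      have "0 \<le> \<bar>a\<bar> * \<bar>b\<bar>" by simp
      moreover have "2 * \<bar>a\<bar> * \<bar>b\<bar> \<le> a\<^sup>2 + b\<^sup>2"
        using sum_squares_bound[of "\<bar>a\<bar>" "\<bar>b\<bar>"] by simp
      ultimately show ?thesis unfolding abs_mult by linarith
    qed
    then show "AE x in M. norm (u x * v x) \<le> norm ((u x)\<^sup>2 + (v x)\<^sup>2)" by simp
  qed simp
  define U where "U = (\<integral>x. (u x)\<^sup>2 \<partial>M)"
  define V where "V = (\<integral>x. (v x)\<^sup>2 \<partial>M)"
  define C where "C = (\<integral>x. u x * v x \<partial>M)"
  \<comment> \<open>The minimiser of this quadratic is r = - C / V. For V = 0 it degenerates to a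
    linear function, which can be nonnegative only if C = 0.\<close>
  have quad: "0 \<le> U + 2 * r * C + r\<^sup>2 * V" for r
  proof -
    have "0 \<le> (\<integral>x. (u x + r * v x)\<^sup>2 \<partial>M)" by simp
    also have "\<dots> = (\<integral>x. (u x)\<^sup>2 + 2 * r * (u x * v x) + r\<^sup>2 * (v x)\<^sup>2 \<partial>M)"
      by (simp add: power2_sum power_mult_distrib algebra_simps)
    also have "\<dots> = U + 2 * r * C + r\<^sup>2 * V"
      using u2 v2 uv by (simp add: U_def V_def C_def)
    finally show ?thesis .
  qed
  have "0 \<le> V" by (simp add: V_def)
  have "C\<^sup>2 \<le> U * V"
  proof (cases "V = 0")
    case True
    then have *: "0 \<le> U + 2 * r * C" for r using quad[of r] by simp
    have "C = 0"
    proof (rule ccontr)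
      assume "C \<noteq> 0"
      then show False using *[of "- (U + 1) / (2 * C)"] by (simp add: field_simps)
    qed
    with True show ?thesis by simp
  next
    case False
    with \<open>0 \<le> V\<close> have "V > 0" by simp
    then have "0 \<le> V * (U + 2 * (- C / V) * C + (- C / V)\<^sup>2 * V)"
      by (intro mult_nonneg_nonneg quad) simp
    also have "\<dots> = U * V - C\<^sup>2"
      using \<open>V > 0\<close> by (simp add: field_simps power2_eq_square)
    finally show ?thesis by simp
  qed
  then show "(\<integral>x. u x * v x \<partial>M)\<^sup>2 \<le> (\<integral>x. (u x)\<^sup>2 \<partial>M) * (\<integral>x. (v x)\<^sup>2 \<partial>M)"
    by (simp add: U_def V_def C_def)
qed

section \<open>Square-integrable complex functions\<close>

lemma L2_D:
  assumes "f \<in> L2 M"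
  shows "f \<in> borel_measurable M" "integrable M (\<lambda>x. (cmod (f x))\<^sup>2)"
  using assms by (auto simp: L2_def)

lemma L2_cnj: "f \<in> L2 M \<Longrightarrow> (\<lambda>x. cnj (f x)) \<in> L2 M"
  by (auto simp: L2_def intro: borel_measurable_continuous_on[OF continuous_on_cnj[OF continuous_on_id]])

lemma L2_cmult: "f \<in> L2 M \<Longrightarrow> (\<lambda>x. c * f x) \<in> L2 M"
  by (auto simp: L2_def norm_mult power_mult_distrib)

lemma cmod_add_squared_le: "(cmod (a + b))\<^sup>2 \<le> 2 * (cmod a)\<^sup>2 + 2 * (cmod b)\<^sup>2"
proof -
  have "(cmod (a + b))\<^sup>2 \<le> (cmod a + cmod b)\<^sup>2"
    by (intro power_mono norm_triangle_ineq) simp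
  also have "\<dots> \<le> 2 * (cmod a)\<^sup>2 + 2 * (cmod b)\<^sup>2"
    using sum_squares_bound[of "cmod a" "cmod b"] by (simp add: power2_sum)
  finally show ?thesis .
qed

lemma L2_add:
  assumes "f \<in> L2 M" "g \<in> L2 M"
  shows "(\<lambda>x. f x + g x) \<in> L2 M"
proof -
  note [measurable] = L2_D(1)[OF assms(1)] L2_D(1)[OF assms(2)]
  have "integrable M (\<lambda>x. (cmod (f x + g x))\<^sup>2)"
  proof (rule Bochner_Integration.integrable_bound)
    show "integrable M (\<lambda>x. 2 * (cmod (f x))\<^sup>2 + 2 * (cmod (g x))\<^sup>2)"
      using assms by (simp add: L2_def)
  qed (use cmod_add_squared_le in simp_all)
  then show ?thesis by (simp add: L2_def)
qed

lemma L2_diff: "f \<in> L2 M \<Longrightarrow> g \<in> L2 M \<Longrightarrow> (\<lambda>x. f x - g x) \<in> L2 M"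
  using L2_add[of f M "\<lambda>x. - 1 * g x"] L2_cmult[of g M "- 1"] by simp

lemma L2_sum: "(\<And>i. i \<in> I \<Longrightarrow> f i \<in> L2 M) \<Longrightarrow> (\<lambda>x. \<Sum>i\<in>I. f i x) \<in> L2 M"
proof (induction I rule: infinite_finite_induct)
  case (insert i I)
  then show ?case by (simp add: L2_add)
qed (simp_all add: L2_def)

lemma L2_mult_integrable:
  assumes "f \<in> L2 M" "g \<in> L2 M"
  shows "integrable M (\<lambda>x. f x * g x)"
proof (rule Bochner_Integration.integrable_bound)
  note [measurable] = L2_D(1)[OF assms(1)] L2_D(1)[OF assms(2)]
  show "integrable M (\<lambda>x. cmod (f x) * cmod (g x))"
    using assms by (intro integral_Cauchy_Schwarz) (simp_all add: L2_def)
  show "(\<lambda>x. f x * g x) \<in> borel_measurable M" by simp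
qed (simp add: norm_mult)

lemma L2_Cauchy_Schwarz:
  assumes "f \<in> L2 M" "g \<in> L2 M"
  shows "(cmod (\<integral>x. f x * g x \<partial>M))\<^sup>2 \<le> (\<integral>x. (cmod (f x))\<^sup>2 \<partial>M) * (\<integral>x. (cmod (g x))\<^sup>2 \<partial>M)"
proof -
  note [measurable] = L2_D(1)[OF assms(1)] L2_D(1)[OF assms(2)]
  have "(cmod (\<integral>x. f x * g x \<partial>M))\<^sup>2 \<le> (\<integral>x. cmod (f x) * cmod (g x) \<partial>M)\<^sup>2"
    by (intro power_mono order_trans[OF integral_norm_bound]) (simp_all add: norm_mult)
  also have "\<dots> \<le> (\<integral>x. (cmod (f x))\<^sup>2 \<partial>M) * (\<integral>x. (cmod (g x))\<^sup>2 \<partial>M)"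
    using assms by (intro integral_Cauchy_Schwarz) (simp_all add: L2_def)
  finally show ?thesis .
qed

context prob_space
begin

lemma L2_const: "(\<lambda>x. c) \<in> L2 M"
  by (simp add: L2_def)

lemma L2_integrable: "f \<in> L2 M \<Longrightarrow> integrable M f"
  using L2_mult_integrable[OF _ L2_const[of 1], of f] by simp

end

text \<open>Transition kernels replace the path space. \<open>P_eq\<close> is stated at every x,
  also where f is not integrable: the integral over the image measure and the integral over the
  paths then have the same default value.\<close>

locale reversible_kernels = prob_space \<mu> for \<mu> :: "'a measure" +
  fixes K :: "real \<Rightarrow> 'a \<Rightarrow> 'a measure" and P :: "real \<Rightarrow> ('a \<Rightarrow> complex) \<Rightarrow> 'a \<Rightarrow> complex"
  assumes K: "t \<ge> 0 \<Longrightarrow> K t \<in> \<mu> \<rightarrow>\<^sub>M prob_algebra \<mu>"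
    and stationary: "t \<ge> 0 \<Longrightarrow> \<mu> \<bind> K t = \<mu>"
    and P_eq: "t \<ge> 0 \<Longrightarrow> f \<in> borel_measurable \<mu> \<Longrightarrow> P t f x = (\<integral>y. f y \<partial>K t x)"
    and rev: "reversible \<mu> P"
begin

lemma K_subprob: "t \<ge> 0 \<Longrightarrow> K t \<in> \<mu> \<rightarrow>\<^sub>M subprob_algebra \<mu>"
  using K by (rule measurable_prob_algebraD)

lemma K_prob_space: "t \<ge> 0 \<Longrightarrow> x \<in> space \<mu> \<Longrightarrow> prob_space (K t x)"
  using measurable_space[OF K] by (simp add: space_prob_algebra)

lemma sets_K: "t \<ge> 0 \<Longrightarrow> x \<in> space \<mu> \<Longrightarrow> sets (K t x) = sets \<mu>"
  using measurable_space[OF K] by (simp add: space_prob_algebra)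

lemma measurable_K: "t \<ge> 0 \<Longrightarrow> x \<in> space \<mu> \<Longrightarrow> borel_measurable (K t x) = borel_measurable \<mu>"
  by (intro measurable_cong_sets sets_K refl)

lemma nn_integral_K:
  assumes "t \<ge> 0" "u \<in> borel_measurable \<mu>"
  shows "(\<integral>\<^sup>+x. \<integral>\<^sup>+y. u y \<partial>K t x \<partial>\<mu>) = (\<integral>\<^sup>+x. u x \<partial>\<mu>)"
  using nn_integral_bind[OF assms(2) K_subprob[OF assms(1)]] stationary[OF assms(1)] by simp

text \<open>By stationarity the kernel integral of the norm of u has the same finite mean as the
  norm itself, so it is finite almost everywhere. Additivity of \<open>P t\<close> below therefore
  holds only outside a null set.\<close>

lemma AE_integrable_K:
  fixes u :: "'a \<Rightarrow> 'b::{banach, second_countable_topology}"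
  assumes t: "t \<ge> 0" and u: "integrable \<mu> u"
  shows "AE x in \<mu>. integrable (K t x) u"
proof -
  note [measurable] = borel_measurable_integrable[OF u] K_subprob[OF t]
  have "(\<integral>\<^sup>+x. \<integral>\<^sup>+y. ennreal (norm (u y)) \<partial>K t x \<partial>\<mu>) < \<infinity>"
    using u by (simp add: nn_integral_K[OF t] integrable_iff_bounded)
  then have "AE x in \<mu>. (\<integral>\<^sup>+y. ennreal (norm (u y)) \<partial>K t x) \<noteq> \<infinity>"
    by (intro nn_integral_PInf_AE) (auto intro: nn_integral_measurable_subprob_algebra measurable_compose[OF K_subprob[OF t]])
  with AE_space show ?thesis
    by eventually_elim (simp add: integrable_iff_bounded measurable_K[OF t] less_top)
qed

lemma P_measurable:
  assumes t: "t \<ge> 0" and f: "f \<in> borel_measurable \<mu>"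
  shows "P t f \<in> borel_measurable \<mu>"
  using measurable_compose[OF K_subprob[OF t] integral_measurable_subprob_algebra[OF f]]
  by (simp add: P_eq[OF t f] fun_eq_iff cong: measurable_cong)

text \<open>Jensen's inequality for the kernel, obtained from Cauchy-Schwarz against the constant 1,
  followed by stationarity.\<close>

lemma
  assumes t: "t \<ge> 0" and f: "f \<in> L2 \<mu>"
  shows P_L2: "P t f \<in> L2 \<mu>"
    and P_contraction: "(\<integral>x. (cmod (P t f x))\<^sup>2 \<partial>\<mu>) \<le> (\<integral>x. (cmod (f x))\<^sup>2 \<partial>\<mu>)"
proof -
  note [measurable] = L2_D(1)[OF f] P_measurable[OF t L2_D(1)[OF f]]
  have "AE x in \<mu>. ennreal ((cmod (P t f x))\<^sup>2) \<le> (\<integral>\<^sup>+y. ennreal ((cmod (f y))\<^sup>2) \<partial>K t x)"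
    using AE_integrable_K[OF t L2_D(2)[OF f]] AE_space
  proof eventually_elim
    case (elim x)
    interpret Kx: prob_space "K t x" by (rule K_prob_space[OF t elim(2)])
    have "f \<in> L2 (K t x)"
      using elim by (simp add: L2_def measurable_K[OF t])
    from L2_Cauchy_Schwarz[OF this Kx.L2_const[of 1]]
    have "(cmod (P t f x))\<^sup>2 \<le> (\<integral>y. (cmod (f y))\<^sup>2 \<partial>K t x)"
      by (simp add: P_eq[OF t L2_D(1)[OF f]] Kx.prob_space)
    then show ?case
      using elim by (simp add: nn_integral_eq_integral)
  qed
  then have "(\<integral>\<^sup>+x. ennreal ((cmod (P t f x))\<^sup>2) \<partial>\<mu>) \<le> (\<integral>\<^sup>+x. \<integral>\<^sup>+y. ennreal ((cmod (f y))\<^sup>2) \<partial>K t x \<partial>\<mu>)"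
    by (rule nn_integral_mono_AE)
  also have "\<dots> = (\<integral>\<^sup>+x. ennreal ((cmod (f x))\<^sup>2) \<partial>\<mu>)"
    by (simp add: nn_integral_K[OF t])
  finally have le: "(\<integral>\<^sup>+x. ennreal ((cmod (P t f x))\<^sup>2) \<partial>\<mu>) \<le> (\<integral>\<^sup>+x. ennreal ((cmod (f x))\<^sup>2) \<partial>\<mu>)" .
  have fin: "(\<integral>\<^sup>+x. ennreal ((cmod (f x))\<^sup>2) \<partial>\<mu>) < \<infinity>"
    using L2_D(2)[OF f] by (simp add: integrable_iff_bounded)
  with le show L2: "P t f \<in> L2 \<mu>"
    by (auto simp: L2_def integrable_iff_bounded)
  show "(\<integral>x. (cmod (P t f x))\<^sup>2 \<partial>\<mu>) \<le> (\<integral>x. (cmod (f x))\<^sup>2 \<partial>\<mu>)"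
    using le L2_D(2)[OF f] L2_D(2)[OF L2] by (simp add: nn_integral_eq_integral)
qed

lemma AE_L2_integrable_K: "t \<ge> 0 \<Longrightarrow> f \<in> L2 \<mu> \<Longrightarrow> AE x in \<mu>. integrable (K t x) f"
  by (intro AE_integrable_K L2_integrable)

lemma P_const: "t \<ge> 0 \<Longrightarrow> AE x in \<mu>. P t (\<lambda>_. c) x = c"
  using AE_space by eventually_elim (simp add: P_eq prob_space.prob_space[OF K_prob_space])

lemma P_add:
  assumes "t \<ge> 0" "f \<in> L2 \<mu>" "g \<in> L2 \<mu>"
  shows "AE x in \<mu>. P t (\<lambda>x. f x + g x) x = P t f x + P t g x"
  using AE_L2_integrable_K[OF assms(1,2)] AE_L2_integrable_K[OF assms(1,3)]
  by eventually_elim (simp add: P_eq[OF assms(1)] L2_D(1) L2_add assms)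

lemma P_cmult: "t \<ge> 0 \<Longrightarrow> f \<in> L2 \<mu> \<Longrightarrow> P t (\<lambda>x. c * f x) x = c * P t f x"
  by (simp add: P_eq L2_D(1)[OF L2_cmult] L2_D(1))

lemma P_cnj: "t \<ge> 0 \<Longrightarrow> f \<in> L2 \<mu> \<Longrightarrow> P t (\<lambda>x. cnj (f x)) x = cnj (P t f x)"
  by (simp add: P_eq L2_D(1)[OF L2_cnj] L2_D(1))

text \<open>Reversibility is a sesquilinear statement. Since \<open>P t\<close> commutes with
  conjugation, applying it to the conjugate of f gives this bilinear form.\<close>

lemma P_symmetric:
  assumes "t \<ge> 0" "f \<in> L2 \<mu>" "g \<in> L2 \<mu>"
  shows "(\<integral>x. f x * P t g x \<partial>\<mu>) = (\<integral>x. P t f x * g x \<partial>\<mu>)"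
  using rev[unfolded reversible_def, rule_format, OF L2_cnj[OF assms(2)] assms(3,1)]
  by (simp add: inner_L2_def P_cnj[OF assms(1,2)])

section \<open>The generator as a derivative in L2\<close>

lemma difference_quotient_L2:
  assumes "t \<ge> 0" "f \<in> L2 \<mu>"
  shows "(\<lambda>x. (P t f x - f x) / complex_of_real t) \<in> L2 \<mu>"
  using L2_cmult[OF L2_diff[OF P_L2[OF assms] assms(2)], of "1 / complex_of_real t"] by simp

lemma generates_const: "generates \<mu> P (\<lambda>_. c) (\<lambda>_. 0)"
proof -
  have "(\<integral>x. (cmod ((P t (\<lambda>_. c) x - c) / complex_of_real t - 0))\<^sup>2 \<partial>\<mu>) = 0" if "t > 0" for t
    using P_const[of t c] that by (intro integral_eq_zero_AE) auto
  then show ?thesis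
    unfolding generates_def
    by (auto intro!: L2_const tendsto_eventually simp: eventually_at_filter)
qed

lemma generates_add:
  assumes f: "generates \<mu> P f f'" and g: "generates \<mu> P g g'"
  shows "generates \<mu> P (\<lambda>x. f x + g x) (\<lambda>x. f' x + g' x)"
proof -
  have L2: "f \<in> L2 \<mu>" "f' \<in> L2 \<mu>" "g \<in> L2 \<mu>" "g' \<in> L2 \<mu>"
    using f g by (auto simp: generates_def)
  let ?D = "\<lambda>h h' t x. (P t h x - h x) / complex_of_real t - h' x"
  let ?N = "\<lambda>h h' t. \<integral>x. (cmod (?D h h' t x))\<^sup>2 \<partial>\<mu>"
  have int: "integrable \<mu> (\<lambda>x. (cmod (?D h h' t x))\<^sup>2)" if "t \<ge> 0" "h \<in> L2 \<mu>" "h' \<in> L2 \<mu>" for h h' t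
    using L2_D(2)[OF L2_diff[OF difference_quotient_L2[OF that(1,2)] that(3)]] .
  have le: "?N (\<lambda>x. f x + g x) (\<lambda>x. f' x + g' x) t \<le> 2 * ?N f f' t + 2 * ?N g g' t" if t: "t > 0" for t
  proof -
    have "?N (\<lambda>x. f x + g x) (\<lambda>x. f' x + g' x) t \<le>
        (\<integral>x. 2 * (cmod (?D f f' t x))\<^sup>2 + 2 * (cmod (?D g g' t x))\<^sup>2 \<partial>\<mu>)"
    proof (rule integral_mono_AE)
      show "AE x in \<mu>. (cmod (?D (\<lambda>x. f x + g x) (\<lambda>x. f' x + g' x) t x))\<^sup>2 \<le>
          2 * (cmod (?D f f' t x))\<^sup>2 + 2 * (cmod (?D g g' t x))\<^sup>2"
        using P_add[OF less_imp_le[OF t] L2(1,3)]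
      proof eventually_elim
        case (elim x)
        have "?D (\<lambda>x. f x + g x) (\<lambda>x. f' x + g' x) t x = ?D f f' t x + ?D g g' t x"
          using t elim by (simp add: field_simps)
        then show ?case by (metis cmod_add_squared_le)
      qed
      show "integrable \<mu> (\<lambda>x. (cmod (?D (\<lambda>x. f x + g x) (\<lambda>x. f' x + g' x) t x))\<^sup>2)"
        using t L2 by (intro int L2_add) auto
      show "integrable \<mu> (\<lambda>x. 2 * (cmod (?D f f' t x))\<^sup>2 + 2 * (cmod (?D g g' t x))\<^sup>2)"
        using t L2 by (intro Bochner_Integration.integrable_add integrable_mult_right int) auto
    qed
    also have "\<dots> = 2 * ?N f f' t + 2 * ?N g g' t"
      using t int L2 by simp
    finally show ?thesis .
  qed
  have lim: "((\<lambda>t. 2 * ?N f f' t + 2 * ?N g g' t) \<longlongrightarrow> 2 * 0 + 2 * 0) (at_right 0)"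
    using f g unfolding generates_def by (intro tendsto_intros) auto
  have "(?N (\<lambda>x. f x + g x) (\<lambda>x. f' x + g' x) \<longlongrightarrow> 0) (at_right 0)"
  proof (rule tendsto_sandwich[OF _ _ tendsto_const])
    show "\<forall>\<^sub>F t in at_right 0. ?N (\<lambda>x. f x + g x) (\<lambda>x. f' x + g' x) t \<le> 2 * ?N f f' t + 2 * ?N g g' t"
      unfolding eventually_at_filter by (auto intro!: always_eventually le)
  qed (use lim in auto)
  then show ?thesis
    unfolding generates_def by (auto intro: L2_add L2)
qed

lemma generates_cmult:
  assumes "generates \<mu> P f f'"
  shows "generates \<mu> P (\<lambda>x. c * f x) (\<lambda>x. c * f' x)"
proof -
  have L2: "f \<in> L2 \<mu>" "f' \<in> L2 \<mu>"
    using assms by (auto simp: generates_def)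
  let ?N = "\<lambda>t. \<integral>x. (cmod ((P t f x - f x) / complex_of_real t - f' x))\<^sup>2 \<partial>\<mu>"
  have lim: "((\<lambda>t. (cmod c)\<^sup>2 * ?N t) \<longlongrightarrow> (cmod c)\<^sup>2 * 0) (at_right 0)"
    using assms unfolding generates_def by (intro tendsto_intros) auto
  have "(cmod c)\<^sup>2 * ?N t =
      (\<integral>x. (cmod ((P t (\<lambda>x. c * f x) x - c * f x) / complex_of_real t - c * f' x))\<^sup>2 \<partial>\<mu>)" if "t > 0" for t
  proof -
    have "(P t (\<lambda>x. c * f x) x - c * f x) / complex_of_real t - c * f' x =
        c * ((P t f x - f x) / complex_of_real t - f' x)" for x
      using that L2 by (simp add: P_cmult right_diff_distrib)
    then show ?thesis by (simp add: norm_mult power_mult_distrib)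
  qed
  then have "((\<lambda>t. \<integral>x. (cmod ((P t (\<lambda>x. c * f x) x - c * f x) / complex_of_real t - c * f' x))\<^sup>2 \<partial>\<mu>)
      \<longlongrightarrow> 0) (at_right 0)"
    using lim by (intro Lim_transform_eventually[OF lim[simplified]])
      (auto simp: eventually_at_filter intro!: always_eventually)
  then show ?thesis
    using L2_cmult[OF L2(1), of c] L2_cmult[OF L2(2), of c] by (simp add: generates_def)
qed

lemma generates_diff:
  "generates \<mu> P f f' \<Longrightarrow> generates \<mu> P g g' \<Longrightarrow> generates \<mu> P (\<lambda>x. f x - g x) (\<lambda>x. f' x - g' x)"
  using generates_add[of f f' "\<lambda>x. - 1 * g x" "\<lambda>x. - 1 * g' x"] generates_cmult[of g g' "- 1"] by simp

lemma generates_sum: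
  "(\<And>i. i \<in> I \<Longrightarrow> generates \<mu> P (f i) (f' i)) \<Longrightarrow>
    generates \<mu> P (\<lambda>x. \<Sum>i\<in>I. f i x) (\<lambda>x. \<Sum>i\<in>I. f' i x)"
  by (induction I rule: infinite_finite_induct) (auto intro: generates_add generates_const)

lemma generates_generator: "f \<in> gen_domain \<mu> P \<Longrightarrow> generates \<mu> P f (generator \<mu> P f)"
  using someI_ex[of "generates \<mu> P f"] by (simp add: gen_domain_def generator_def)

text \<open>Strong convergence of the difference quotients implies weak convergence, by
  Cauchy-Schwarz. Symmetry, uniqueness and sign of the generator are all read off from this
  limit.\<close>

lemma tendsto_pairing_generator:
  assumes a: "a \<in> L2 \<mu>" and f: "generates \<mu> P f f'"
  shows "((\<lambda>t. ((\<integral>x. a x * P t f x \<partial>\<mu>) - (\<integral>x. a x * f x \<partial>\<mu>)) / complex_of_real t) \<longlongrightarrow> (\<integral>x. a x * f' x \<partial>\<mu>)) (at_right 0)"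
proof -
  have L2: "f \<in> L2 \<mu>" "f' \<in> L2 \<mu>"
    using f by (auto simp: generates_def)
  let ?D = "\<lambda>t x. (P t f x - f x) / complex_of_real t - f' x"
  define A where "A = (\<integral>x. (cmod (a x))\<^sup>2 \<partial>\<mu>)"
  have bound: "cmod (((\<integral>x. a x * P t f x \<partial>\<mu>) - (\<integral>x. a x * f x \<partial>\<mu>)) / complex_of_real t - (\<integral>x. a x * f' x \<partial>\<mu>))
      \<le> sqrt (A * (\<integral>x. (cmod (?D t x))\<^sup>2 \<partial>\<mu>))" if t: "t > 0" for t
  proof -
    have i: "integrable \<mu> (\<lambda>x. a x * P t f x)" "integrable \<mu> (\<lambda>x. a x * f x)" "integrable \<mu> (\<lambda>x. a x * f' x)"
      using t by (auto intro!: L2_mult_integrable a L2 P_L2)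
    have "a x * ?D t x = (a x * P t f x - a x * f x) / complex_of_real t - a x * f' x" for x
      by (simp add: right_diff_distrib diff_divide_distrib)
    then have "((\<integral>x. a x * P t f x \<partial>\<mu>) - (\<integral>x. a x * f x \<partial>\<mu>)) / complex_of_real t - (\<integral>x. a x * f' x \<partial>\<mu>) = (\<integral>x. a x * ?D t x \<partial>\<mu>)"
      using i by (simp only: Bochner_Integration.integral_diff Bochner_Integration.integrable_diff
          integral_divide_zero integrable_divide)
    then show ?thesis
      using t L2_Cauchy_Schwarz[OF a L2_diff[OF difference_quotient_L2[OF less_imp_le[OF t] L2(1)] L2(2)]]
      by (simp add: A_def real_le_rsqrt)
  qed
  have lim: "((\<lambda>t. sqrt (A * (\<integral>x. (cmod (?D t x))\<^sup>2 \<partial>\<mu>))) \<longlongrightarrow> sqrt (A * 0)) (at_right 0)"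
    using f unfolding generates_def by (intro tendsto_intros) auto
  show ?thesis
    by (rule LIM_zero_cancel, rule Lim_null_comparison[OF _ lim[simplified]])
      (auto simp: eventually_at_filter intro!: always_eventually bound)
qed

lemma generator_symmetric:
  assumes f: "generates \<mu> P f f'" and g: "generates \<mu> P g g'"
  shows "(\<integral>x. f x * g' x \<partial>\<mu>) = (\<integral>x. f' x * g x \<partial>\<mu>)"
proof (rule tendsto_unique[OF trivial_limit_at_right_real])
  have L2: "f \<in> L2 \<mu>" "g \<in> L2 \<mu>"
    using f g by (auto simp: generates_def)
  show "((\<lambda>t. ((\<integral>x. f x * P t g x \<partial>\<mu>) - (\<integral>x. f x * g x \<partial>\<mu>)) / complex_of_real t) \<longlongrightarrow> (\<integral>x. f x * g' x \<partial>\<mu>)) (at_right 0)"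
    by (rule tendsto_pairing_generator[OF L2(1) g])
  show "((\<lambda>t. ((\<integral>x. f x * P t g x \<partial>\<mu>) - (\<integral>x. f x * g x \<partial>\<mu>)) / complex_of_real t) \<longlongrightarrow> (\<integral>x. f' x * g x \<partial>\<mu>)) (at_right 0)"
    by (rule Lim_transform_eventually[OF tendsto_pairing_generator[OF L2(2) f, unfolded mult.commute[of "g _"]]])
      (auto simp: eventually_at_filter P_symmetric[OF _ L2] intro!: always_eventually)
qed

text \<open>Symmetry tested against the constant 1, which has derivative 0.\<close>

lemma integral_generator: "generates \<mu> P f f' \<Longrightarrow> (\<integral>x. f' x \<partial>\<mu>) = 0"
  using generator_symmetric[OF generates_const[of 1], of f f'] by simp

text \<open>\<open>generator\<close> is an arbitrary choice. Under an integral against an L2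
  function it may be exchanged for a derivative computed by hand.\<close>

lemma pairing_generator_unique:
  assumes "a \<in> L2 \<mu>" "generates \<mu> P f f'" "generates \<mu> P f f''"
  shows "(\<integral>x. a x * f' x \<partial>\<mu>) = (\<integral>x. a x * f'' x \<partial>\<mu>)"
  by (rule tendsto_unique[OF trivial_limit_at_right_real])
    (rule tendsto_pairing_generator[OF assms(1,2)] tendsto_pairing_generator[OF assms(1,3)])+

text \<open>Contractivity bounds the pairing of f with \<open>P t f\<close> by the squared norm of
  f, so every difference quotient is nonpositive.\<close>

lemma generator_nonpos:
  assumes "generates \<mu> P f f'"
  shows "Re (\<integral>x. cnj (f x) * f' x \<partial>\<mu>) \<le> 0"
proof -
  have f: "f \<in> L2 \<mu>" using assms by (simp add: generates_def)
  have "Re (((\<integral>x. cnj (f x) * P t f x \<partial>\<mu>) - (\<integral>x. cnj (f x) * f x \<partial>\<mu>)) / complex_of_real t) \<le> 0"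
    if t: "t > 0" for t
  proof -
    define A where "A = (\<integral>x. (cmod (f x))\<^sup>2 \<partial>\<mu>)"
    have "(cmod (\<integral>x. cnj (f x) * P t f x \<partial>\<mu>))\<^sup>2 \<le> A * (\<integral>x. (cmod (P t f x))\<^sup>2 \<partial>\<mu>)"
      using L2_Cauchy_Schwarz[OF L2_cnj[OF f] P_L2[OF _ f], of t] t by (simp add: A_def)
    also have "\<dots> \<le> A * A"
      using P_contraction[OF _ f, of t] t by (intro mult_left_mono) (auto simp: A_def)
    finally have "(cmod (\<integral>x. cnj (f x) * P t f x \<partial>\<mu>))\<^sup>2 \<le> A\<^sup>2"
      by (simp only: power2_eq_square)
    moreover have "0 \<le> A" by (simp add: A_def)
    ultimately have "cmod (\<integral>x. cnj (f x) * P t f x \<partial>\<mu>) \<le> A"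
      by (rule power2_le_imp_le)
    then have "Re (\<integral>x. cnj (f x) * P t f x \<partial>\<mu>) \<le> A"
      by (rule order_trans[OF complex_Re_le_cmod])
    moreover have "(\<integral>x. cnj (f x) * f x \<partial>\<mu>) = (\<integral>x. complex_of_real ((cmod (f x))\<^sup>2) \<partial>\<mu>)"
      by (intro Bochner_Integration.integral_cong refl) (simp only: complex_norm_square mult.commute)
    then have "(\<integral>x. cnj (f x) * f x \<partial>\<mu>) = complex_of_real A"
      by (simp only: integral_complex_of_real A_def)
    ultimately show ?thesis using t by (simp add: divide_le_0_iff del: of_real_power)
  qed
  then have "\<forall>\<^sub>F t in at_right 0. Re (((\<integral>x. cnj (f x) * P t f x \<partial>\<mu>) - (\<integral>x. cnj (f x) * f x \<partial>\<mu>)) / complex_of_real t) \<le> 0"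
    by (auto simp: eventually_at_filter intro!: always_eventually)
  then show ?thesis
    by (rule tendsto_le[OF trivial_limit_at_right_real tendsto_const
          tendsto_Re[OF tendsto_pairing_generator[OF L2_cnj[OF f] assms]]])
qed

end

section \<open>Dirichlet forms of matrix powers\<close>

lemma matpow_2: "matpow A 2 = A ** A"
  by (simp add: numeral_2_eq_2)

text \<open>Pure powers are written as products with a zeroth power, so that every term becomes a
  two-time correlation after averaging.\<close>

lemma matpow_pair_inequality:
  fixes n :: nat
  defines "k \<equiv> Suc n"
  assumes "hermitian A" "hermitian B"
  shows "2 * (matpow A (2 * k) \<bullet> matpow B 0 - 2 * (matpow A k \<bullet> matpow B k) + matpow A 0 \<bullet> matpow B (2 * k))
    \<le> (real k)\<^sup>2 * ((matpow A (2 * n) \<bullet> matpow B 2 - 2 * (matpow A (2 * n + 1) \<bullet> matpow B 1) + matpow A (2 * k) \<bullet> matpow B 0)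
      + (matpow A 2 \<bullet> matpow B (2 * n) - 2 * (matpow A 1 \<bullet> matpow B (2 * n + 1)) + matpow A 0 \<bullet> matpow B (2 * k)))"
proof -
  have sq: "(norm (matpow C k))\<^sup>2 = matpow C (2 * k) \<bullet> mat 1" if "hermitian C" for C :: "complex^'n^'n" and k
    using inner_matpow_eq[OF that, of k k "2 * k" 0] by (simp add: power2_norm_eq_inner)
  have 1: "(norm (matpow A k - matpow B k))\<^sup>2 = matpow A (2 * k) \<bullet> matpow B 0 - 2 * (matpow A k \<bullet> matpow B k) + matpow A 0 \<bullet> matpow B (2 * k)"
  proof -
    have "(norm (matpow A k - matpow B k))\<^sup>2 = (norm (matpow A k))\<^sup>2 - 2 * (matpow A k \<bullet> matpow B k) + (norm (matpow B k))\<^sup>2"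
      by (simp add: power2_norm_eq_inner inner_diff_left inner_diff_right inner_commute)
    then show ?thesis by (simp add: sq assms(2,3) inner_commute)
  qed
  have 2: "(norm ((A - B) ** matpow A n))\<^sup>2 = matpow A (2 * n) \<bullet> matpow B 2 - 2 * (matpow A (2 * n + 1) \<bullet> matpow B 1) + matpow A (2 * k) \<bullet> matpow B 0"
    unfolding norm_diff_mult_matpow[OF assms(2,3)] by (simp add: sq assms(2,3) k_def del: matpow.simps(2))
  have "(A - B) ** matpow B n = - ((B - A) ** matpow B n)"
    by (simp add: matrix_diff_rdistrib)
  then have "norm ((A - B) ** matpow B n) = norm ((B - A) ** matpow B n)"
    by (metis norm_minus_cancel)
  then have 3: "(norm ((A - B) ** matpow B n))\<^sup>2 = matpow A 2 \<bullet> matpow B (2 * n) - 2 * (matpow A 1 \<bullet> matpow B (2 * n + 1)) + matpow A 0 \<bullet> matpow B (2 * k)"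
    by (simp add: norm_diff_mult_matpow[OF assms(3,2)] sq assms(2,3) k_def inner_commute del: matpow.simps(2))
  show ?thesis
    using norm_matpow_diff_le[OF assms(2,3), of n] unfolding k_def[symmetric] 1 2 3 .
qed

text \<open>With \<open>X\<close> and \<open>Y\<close> the generator applied to g and to its square,
  the bracket is the carre du champ. Both \<open>A ** X\<close> and \<open>X ** A\<close> have the
  same pairing with a power of \<open>A\<close>, so noncommutativity does no harm.\<close>

lemma inner_matpow_carre:
  assumes "hermitian A"
  shows "matpow A (2 * n) \<bullet> Y - 2 * (matpow A (2 * n + 1) \<bullet> X) =
    2 * (matpow A n \<bullet> (((1 / 2) *\<^sub>R (Y - A ** X - X ** A)) ** matpow A n))"
proof -
  have *: "matpow A (2 * n) \<bullet> Z = matpow A n \<bullet> (Z ** matpow A n)" for Z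
    using inner_mult_hermitian_right[OF hermitian_matpow[OF assms], of "matpow A n" n Z]
    by (simp add: mult_2 matpow_add)
  have 1: "matpow A (2 * n) \<bullet> (A ** X) = matpow A (2 * n + 1) \<bullet> X"
    using inner_mult_hermitian_left[OF assms, of "matpow A (2 * n)" X] by simp
  have 2: "matpow A (2 * n) \<bullet> (X ** A) = matpow A (2 * n + 1) \<bullet> X"
    using inner_mult_hermitian_right[OF assms, of "matpow A (2 * n)" X] by (simp add: matpow_mult_commute)
  have "2 * (matpow A n \<bullet> (((1 / 2) *\<^sub>R (Y - A ** X - X ** A)) ** matpow A n)) =
      2 * (matpow A (2 * n) \<bullet> ((1 / 2) *\<^sub>R (Y - A ** X - X ** A)))"
    unfolding * ..
  also have "\<dots> = matpow A (2 * n) \<bullet> Y - 2 * (matpow A (2 * n + 1) \<bullet> X)"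
    unfolding inner_scaleR_right inner_diff_right 1 2 by simp
  finally show ?thesis ..
qed

lemma inner_op_norm_le:
  fixes C N :: "complex^'n^'n"
  assumes "op_norm C \<le> c"
  shows "x \<bullet> (C *v x) \<le> c * (norm x)\<^sup>2"
proof -
  have "x \<bullet> (C *v x) \<le> norm x * (op_norm C * norm x)"
    by (rule order_trans[OF norm_cauchy_schwarz mult_left_mono[OF norm_matrix_vector_mult_le_op_norm]]) simp
  also have "\<dots> = op_norm C * (norm x)\<^sup>2" by (simp add: power2_eq_square)
  also have "\<dots> \<le> c * (norm x)\<^sup>2" using assms by (intro mult_right_mono) auto
  finally show ?thesis .
qed

section \<open>Expectations of products of matrix-valued functions\<close>

lemma entries_in_L2_inner:
  fixes F G :: "'a \<Rightarrow> complex^'n^'n"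
  assumes "entries_in F (L2 M)" "entries_in G (L2 M)"
  shows "integrable M (\<lambda>x. F x \<bullet> G x)"
    and "(\<integral>x. F x \<bullet> G x \<partial>M) = Re (\<Sum>i\<in>UNIV. \<Sum>j\<in>UNIV. \<integral>x. cnj (F x $ i $ j) * G x $ i $ j \<partial>M)"
proof -
  have i: "integrable M (\<lambda>x. cnj (F x $ i $ j) * G x $ i $ j)" for i j
    using assms unfolding entries_in_def by (intro L2_mult_integrable L2_cnj) auto
  then have j: "integrable M (\<lambda>x. \<Sum>i\<in>UNIV. \<Sum>j\<in>UNIV. cnj (F x $ i $ j) * G x $ i $ j)"
    by (intro Bochner_Integration.integrable_sum)
  then show "integrable M (\<lambda>x. F x \<bullet> G x)"
    unfolding inner_matrix by (rule integrable_Re)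
  show "(\<integral>x. F x \<bullet> G x \<partial>M) = Re (\<Sum>i\<in>UNIV. \<Sum>j\<in>UNIV. \<integral>x. cnj (F x $ i $ j) * G x $ i $ j \<partial>M)"
    unfolding inner_matrix integral_Re[OF j] using i by simp
qed

lemma entries_integrable_inner_const:
  fixes G :: "'a \<Rightarrow> complex^'n^'n"
  assumes "\<And>i j. integrable M (\<lambda>x. G x $ i $ j)"
  shows "integrable M (\<lambda>x. A \<bullet> G x)"
    and "(\<integral>x. A \<bullet> G x \<partial>M) = A \<bullet> mexpectation M G"
proof -
  have i: "integrable M (\<lambda>x. cnj (A $ i $ j) * G x $ i $ j)" for i j
    using assms by simp
  then have j: "integrable M (\<lambda>x. \<Sum>i\<in>UNIV. \<Sum>j\<in>UNIV. cnj (A $ i $ j) * G x $ i $ j)"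
    by (intro Bochner_Integration.integrable_sum)
  then show "integrable M (\<lambda>x. A \<bullet> G x)"
    unfolding inner_matrix by (rule integrable_Re)
  show "(\<integral>x. A \<bullet> G x \<partial>M) = A \<bullet> mexpectation M G"
    unfolding inner_matrix integral_Re[OF j] mexpectation_def using i assms by simp
qed

lemma integrable_mult_entries:
  assumes "entries_in F (L2 M)" "entries_in G (L2 M)"
  shows "integrable M (\<lambda>x. (F x ** G x) $ i $ j)"
  unfolding matrix_matrix_mult_def
  using assms by (auto simp: entries_in_def intro!: L2_mult_integrable)

lemma mexpectation_mult_nth:
  assumes "entries_in F (L2 M)" "entries_in G (L2 M)"
  shows "mexpectation M (\<lambda>x. F x ** G x) $ i $ j = (\<Sum>l\<in>UNIV. \<integral>x. F x $ i $ l * G x $ l $ j \<partial>M)"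
  unfolding matrix_matrix_mult_def mexpectation_def
  using assms by (auto simp: entries_in_def intro!: Bochner_Integration.integral_sum L2_mult_integrable)

lemma Re_trace_mexpectation_mult:
  assumes "\<And>x. hermitian (F x)" "entries_in F (L2 M)" "entries_in G (L2 M)"
  shows "Re (trace (mexpectation M (\<lambda>x. F x ** G x))) = (\<integral>x. F x \<bullet> G x \<partial>M)"
proof -
  have "Re (trace (mexpectation M (\<lambda>x. F x ** G x))) = Re (\<integral>x. trace (F x ** G x) \<partial>M)"
    unfolding trace_def mexpectation_def using integrable_mult_entries[OF assms(2,3)]
    by (simp add: Bochner_Integration.integral_sum)
  also have "\<dots> = (\<integral>x. Re (trace (F x ** G x)) \<partial>M)"
    unfolding trace_def using integrable_mult_entries[OF assms(2,3)]
    by (intro integral_Re[symmetric] Bochner_Integration.integrable_sum)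
  finally show ?thesis by (simp add: Re_trace_mult_hermitian assms(1))
qed

section \<open>Two-time correlations of matrix powers and their derivative at time 0\<close>

context reversible_kernels
begin

definition mP :: "real \<Rightarrow> ('a \<Rightarrow> complex^'n^'n) \<Rightarrow> 'a \<Rightarrow> complex^'n^'n" where
  "mP t F x = (\<chi> i j. P t (\<lambda>y. F y $ i $ j) x)"

text \<open>A relation rather than a function, because derivatives obtained by linearity agree with
  the chosen \<open>mgenerator\<close> only almost everywhere.\<close>

definition mgenerates :: "('a \<Rightarrow> complex^'n^'n) \<Rightarrow> ('a \<Rightarrow> complex^'n^'n) \<Rightarrow> bool" where
  "mgenerates F F' \<longleftrightarrow> (\<forall>i j. generates \<mu> P (\<lambda>x. F x $ i $ j) (\<lambda>x. F' x $ i $ j))"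

lemma mgenerates_L2: "mgenerates F F' \<Longrightarrow> entries_in F (L2 \<mu>)" "mgenerates F F' \<Longrightarrow> entries_in F' (L2 \<mu>)"
  by (auto simp: mgenerates_def entries_in_def generates_def)

lemma mgenerates_mgenerator: "entries_in F (gen_domain \<mu> P) \<Longrightarrow> mgenerates F (mgenerator \<mu> P F)"
  by (simp add: mgenerates_def entries_in_def mgenerator_def generates_generator)

lemma mP_L2: "t \<ge> 0 \<Longrightarrow> entries_in F (L2 \<mu>) \<Longrightarrow> entries_in (mP t F) (L2 \<mu>)"
  using P_L2 by (simp add: entries_in_def mP_def)

lemma integral_inner_mP_symmetric:
  fixes F G :: "'a \<Rightarrow> complex^'n^'n"
  assumes t: "t \<ge> 0" and F: "entries_in F (L2 \<mu>)" and G: "entries_in G (L2 \<mu>)"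
  shows "(\<integral>x. F x \<bullet> mP t G x \<partial>\<mu>) = (\<integral>x. mP t F x \<bullet> G x \<partial>\<mu>)"
proof -
  have "(\<integral>x. cnj (F x $ i $ j) * P t (\<lambda>y. G y $ i $ j) x \<partial>\<mu>) =
      (\<integral>x. cnj (P t (\<lambda>y. F y $ i $ j) x) * G x $ i $ j \<partial>\<mu>)" for i j
    using F G P_symmetric[OF t L2_cnj, of "\<lambda>x. F x $ i $ j" "\<lambda>x. G x $ i $ j"]
    by (simp add: entries_in_def P_cnj[OF t])
  then show ?thesis
    by (simp add: entries_in_L2_inner(2) F G mP_L2[OF t]) (simp add: mP_def)
qed

lemma integral_inner_mP_const:
  fixes F :: "'a \<Rightarrow> complex^'n^'n"
  assumes t: "t \<ge> 0" and F: "entries_in F (L2 \<mu>)"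
  shows "(\<integral>x. F x \<bullet> mP t (\<lambda>_. C) x \<partial>\<mu>) = (\<integral>x. F x \<bullet> C \<partial>\<mu>)"
proof -
  have "AE x in \<mu>. \<forall>i j. P t (\<lambda>_. C $ i $ j) x = C $ i $ j"
    unfolding AE_all_countable using P_const[OF t] by blast
  then have AE: "AE x in \<mu>. mP t (\<lambda>_. C) x = C"
    by eventually_elim (simp add: mP_def vec_eq_iff)
  have C: "entries_in (\<lambda>_. C) (L2 \<mu>)"
    by (simp add: entries_in_def L2_const)
  show ?thesis
    by (rule integral_cong_AE[OF borel_measurable_integrable borel_measurable_integrable])
      (use AE in \<open>auto intro!: entries_in_L2_inner F C mP_L2 t\<close>)
qed

lemma tendsto_inner_generator:
  fixes F G :: "'a \<Rightarrow> complex^'n^'n"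
  assumes F: "entries_in F (L2 \<mu>)" and G: "mgenerates G G'"
  shows "((\<lambda>t. ((\<integral>x. F x \<bullet> mP t G x \<partial>\<mu>) - (\<integral>x. F x \<bullet> G x \<partial>\<mu>)) / t) \<longlongrightarrow> (\<integral>x. F x \<bullet> G' x \<partial>\<mu>)) (at_right 0)"
proof -
  let ?Q = "\<lambda>i j t. ((\<integral>x. cnj (F x $ i $ j) * P t (\<lambda>y. G y $ i $ j) x \<partial>\<mu>) - (\<integral>x. cnj (F x $ i $ j) * G x $ i $ j \<partial>\<mu>)) / complex_of_real t"
  have "((\<lambda>t. Re (\<Sum>i\<in>UNIV. \<Sum>j\<in>UNIV. ?Q i j t)) \<longlongrightarrow>
      Re (\<Sum>i\<in>UNIV. \<Sum>j\<in>UNIV. \<integral>x. cnj (F x $ i $ j) * G' x $ i $ j \<partial>\<mu>)) (at_right 0)"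
    using F G unfolding entries_in_def mgenerates_def
    by (intro tendsto_intros tendsto_pairing_generator L2_cnj) auto
  moreover have "Re (\<Sum>i\<in>UNIV. \<Sum>j\<in>UNIV. ?Q i j t) = ((\<integral>x. F x \<bullet> mP t G x \<partial>\<mu>) - (\<integral>x. F x \<bullet> G x \<partial>\<mu>)) / t"
    if "t > 0" for t
    using that
    by (simp add: entries_in_L2_inner(2) F mgenerates_L2[OF G] mP_L2)
      (simp add: mP_def sum_subtractf[symmetric] sum_divide_distrib[symmetric])
  ultimately show ?thesis
    unfolding entries_in_L2_inner(2)[OF F mgenerates_L2(2)[OF G]]
    by (elim Lim_transform_eventually) (auto simp: eventually_at_filter intro!: always_eventually)
qed


text \<open>That is, the expectation of \<open>g(X\<^sub>0)\<^sup>i \<bullet> g(X\<^sub>t)\<^sup>j\<close> for the process started from \<open>\<mu>\<close>.\<close>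

definition autocorr :: "('a \<Rightarrow> complex^'n^'n) \<Rightarrow> nat \<Rightarrow> nat \<Rightarrow> real \<Rightarrow> real" where
  "autocorr g i j t = (\<integral>x. matpow (g x) i \<bullet> mP t (\<lambda>y. matpow (g y) j) x \<partial>\<mu>)"

lemma autocorr_sym:
  assumes "t \<ge> 0" "\<And>k. entries_in (\<lambda>x. matpow (g x) k) (L2 \<mu>)"
  shows "autocorr g i j t = autocorr g j i t"
  unfolding autocorr_def integral_inner_mP_symmetric[OF assms(1) assms(2) assms(2), of i j]
  by (simp add: inner_commute)

lemma autocorr_0:
  assumes t: "t \<ge> 0" and L2: "\<And>k. entries_in (\<lambda>x. matpow (g x) k) (L2 \<mu>)"
  shows "autocorr g i 0 t = (\<integral>x. matpow (g x) i \<bullet> mat 1 \<partial>\<mu>)"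
  using integral_inner_mP_const[OF t L2, of i "mat 1"] by (simp add: autocorr_def)

text \<open>The pair inequality is integrated twice: over \<open>B\<close> = g y with respect to
  \<open>K t x\<close>, then over \<open>A\<close> = g x with respect to \<mu>, so no joint law is
  needed. Symmetry of the correlations identifies the terms with the two times exchanged, and a
  common factor 2 drops out.\<close>

lemma autocorr_inequality:
  fixes g :: "'a \<Rightarrow> complex^'n^'n" and n :: nat
  defines "k \<equiv> Suc n"
  assumes t: "t \<ge> 0" and herm: "\<And>x. hermitian (g x)"
    and L2: "\<And>k. entries_in (\<lambda>x. matpow (g x) k) (L2 \<mu>)"
  defines "c \<equiv> \<integral>x. matpow (g x) (2 * k) \<bullet> mat 1 \<partial>\<mu>"
  shows "2 * (c - autocorr g k k t) \<le>
    (real k)\<^sup>2 * (autocorr g (2 * n) 2 t - 2 * autocorr g (2 * n + 1) 1 t + c)"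
proof -
  let ?h = "\<lambda>j x. mP t (\<lambda>y. matpow (g y) j) x"
  \<comment> \<open>There are countably many powers and entries, so a single null set serves them
    all.\<close>
  have "AE x in \<mu>. \<forall>j i l. integrable (K t x) (\<lambda>y. matpow (g y) j $ i $ l)"
    unfolding AE_all_countable using AE_L2_integrable_K[OF t] L2 by (auto simp: entries_in_def)
  then have AE: "AE x in \<mu>. 2 * (matpow (g x) (2 * k) \<bullet> ?h 0 x - 2 * (matpow (g x) k \<bullet> ?h k x) + matpow (g x) 0 \<bullet> ?h (2 * k) x)
    \<le> (real k)\<^sup>2 * ((matpow (g x) (2 * n) \<bullet> ?h 2 x - 2 * (matpow (g x) (2 * n + 1) \<bullet> ?h 1 x) + matpow (g x) (2 * k) \<bullet> ?h 0 x)
      + (matpow (g x) 2 \<bullet> ?h (2 * n) x - 2 * (matpow (g x) 1 \<bullet> ?h (2 * n + 1) x) + matpow (g x) 0 \<bullet> ?h (2 * k) x))"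
  proof eventually_elim
    case (elim x)
    have int: "integrable (K t x) (\<lambda>y. A \<bullet> matpow (g y) j)" for A j
      by (rule entries_integrable_inner_const) (use elim in blast)
    have h: "A \<bullet> ?h j x = (\<integral>y. A \<bullet> matpow (g y) j \<partial>K t x)" for A j
    proof -
      have "?h j x = mexpectation (K t x) (\<lambda>y. matpow (g y) j)"
        using L2[of j] by (auto simp: mP_def mexpectation_def P_eq[OF t] entries_in_def L2_D vec_eq_iff)
      then show ?thesis
        by (subst entries_integrable_inner_const(2)) (use elim in auto)
    qed
    let ?I = "\<lambda>A j. (\<integral>y. A \<bullet> matpow (g y) j \<partial>K t x)"
    let ?L = "\<lambda>y. 2 * (matpow (g x) (2 * k) \<bullet> matpow (g y) 0 - 2 * (matpow (g x) k \<bullet> matpow (g y) k) + matpow (g x) 0 \<bullet> matpow (g y) (2 * k))"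
    let ?R = "\<lambda>y. (real k)\<^sup>2 * ((matpow (g x) (2 * n) \<bullet> matpow (g y) 2 - 2 * (matpow (g x) (2 * n + 1) \<bullet> matpow (g y) 1) + matpow (g x) (2 * k) \<bullet> matpow (g y) 0)
      + (matpow (g x) 2 \<bullet> matpow (g y) (2 * n) - 2 * (matpow (g x) 1 \<bullet> matpow (g y) (2 * n + 1)) + matpow (g x) 0 \<bullet> matpow (g y) (2 * k)))"
    have le: "integral\<^sup>L (K t x) ?L \<le> integral\<^sup>L (K t x) ?R"
      using matpow_pair_inequality[OF herm[of x] herm, where n = n, folded k_def]
      by (intro integral_mono Bochner_Integration.integrable_add Bochner_Integration.integrable_diff
          integrable_mult_right int) auto
    have L: "integral\<^sup>L (K t x) ?L = 2 * (?I (matpow (g x) (2 * k)) 0 - 2 * ?I (matpow (g x) k) k + ?I (matpow (g x) 0) (2 * k))"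
      by (simp only: int Bochner_Integration.integral_add Bochner_Integration.integral_diff
          integral_mult_right_zero Bochner_Integration.integrable_add Bochner_Integration.integrable_diff integrable_mult_right)
    have R: "integral\<^sup>L (K t x) ?R = (real k)\<^sup>2 * ((?I (matpow (g x) (2 * n)) 2 - 2 * ?I (matpow (g x) (2 * n + 1)) 1 + ?I (matpow (g x) (2 * k)) 0)
      + (?I (matpow (g x) 2) (2 * n) - 2 * ?I (matpow (g x) 1) (2 * n + 1) + ?I (matpow (g x) 0) (2 * k)))"
      by (simp only: int Bochner_Integration.integral_add Bochner_Integration.integral_diff
          integral_mult_right_zero Bochner_Integration.integrable_add Bochner_Integration.integrable_diff integrable_mult_right)
    show ?case using le unfolding h L R .
  qed
  have int: "integrable \<mu> (\<lambda>x. matpow (g x) i \<bullet> ?h j x)" for i j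
    by (intro entries_in_L2_inner L2 mP_L2 t)
  let ?L = "\<lambda>x. 2 * (matpow (g x) (2 * k) \<bullet> ?h 0 x - 2 * (matpow (g x) k \<bullet> ?h k x) + matpow (g x) 0 \<bullet> ?h (2 * k) x)"
  let ?R = "\<lambda>x. (real k)\<^sup>2 * ((matpow (g x) (2 * n) \<bullet> ?h 2 x - 2 * (matpow (g x) (2 * n + 1) \<bullet> ?h 1 x) + matpow (g x) (2 * k) \<bullet> ?h 0 x)
      + (matpow (g x) 2 \<bullet> ?h (2 * n) x - 2 * (matpow (g x) 1 \<bullet> ?h (2 * n + 1) x) + matpow (g x) 0 \<bullet> ?h (2 * k) x))"
  from AE have le: "integral\<^sup>L \<mu> ?L \<le> integral\<^sup>L \<mu> ?R"
    by (intro integral_mono_AE Bochner_Integration.integrable_add Bochner_Integration.integrable_diff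
        integrable_mult_right int)
  have L: "integral\<^sup>L \<mu> ?L = 2 * (autocorr g (2 * k) 0 t - 2 * autocorr g k k t + autocorr g 0 (2 * k) t)"
    unfolding autocorr_def
    by (simp only: int Bochner_Integration.integral_add Bochner_Integration.integral_diff
        integral_mult_right_zero Bochner_Integration.integrable_add Bochner_Integration.integrable_diff integrable_mult_right)
  have R: "integral\<^sup>L \<mu> ?R = (real k)\<^sup>2 * ((autocorr g (2 * n) 2 t - 2 * autocorr g (2 * n + 1) 1 t + autocorr g (2 * k) 0 t)
      + (autocorr g 2 (2 * n) t - 2 * autocorr g 1 (2 * n + 1) t + autocorr g 0 (2 * k) t))"
    unfolding autocorr_def
    by (simp only: int Bochner_Integration.integral_add Bochner_Integration.integral_diff
        integral_mult_right_zero Bochner_Integration.integrable_add Bochner_Integration.integrable_diff integrable_mult_right)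
  show ?thesis
    using le unfolding L R autocorr_sym[OF t L2, of 0] autocorr_sym[OF t L2, of 2]
      autocorr_sym[OF t L2, of 1] autocorr_0[OF t L2] c_def[symmetric]
    by (simp add: algebra_simps)
qed

text \<open>All products of two powers with exponents summing to 2 (n + 1) have the same integral c.
  In \<open>autocorr_inequality\<close> the coefficients of c cancel on both sides, so that division
  by t leaves difference quotients and t may tend to 0.\<close>

lemma dirichlet_matpow_inequality:
  fixes g :: "'a \<Rightarrow> complex^'n^'n" and n :: nat
  assumes herm: "\<And>x. hermitian (g x)"
    and L2: "\<And>k. entries_in (\<lambda>x. matpow (g x) k) (L2 \<mu>)"
    and X: "mgenerates g X" and Y: "mgenerates (\<lambda>x. g x ** g x) Y"
    and Z: "mgenerates (\<lambda>x. matpow (g x) (Suc n)) Z"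
  shows "- 2 * (\<integral>x. matpow (g x) (Suc n) \<bullet> Z x \<partial>\<mu>) \<le>
    (real (Suc n))\<^sup>2 * ((\<integral>x. matpow (g x) (2 * n) \<bullet> Y x \<partial>\<mu>) - 2 * (\<integral>x. matpow (g x) (2 * n + 1) \<bullet> X x \<partial>\<mu>))"
proof (rule tendsto_le[OF trivial_limit_at_right_real])
  let ?k = "Suc n"
  define c where "c = (\<integral>x. matpow (g x) (2 * ?k) \<bullet> mat 1 \<partial>\<mu>)"
  have c: "(\<integral>x. matpow (g x) i \<bullet> matpow (g x) j \<partial>\<mu>) = c" if "i + j = 2 * ?k" for i j
    unfolding c_def by (intro Bochner_Integration.integral_cong refl)
      (use inner_matpow_eq[OF herm, of i j "2 * ?k" 0] that in simp)
  have XYZ: "mgenerates (\<lambda>x. matpow (g x) 1) X" "mgenerates (\<lambda>x. matpow (g x) 2) Y"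
    using X Y by (simp_all add: matpow_2)
  have lim: "((\<lambda>t. (autocorr g i j t - c) / t) \<longlongrightarrow> (\<integral>x. matpow (g x) i \<bullet> G x \<partial>\<mu>)) (at_right 0)"
    if "mgenerates (\<lambda>x. matpow (g x) j) G" "i + j = 2 * ?k" for i j G
    unfolding autocorr_def c[OF that(2), symmetric] by (rule tendsto_inner_generator[OF L2 that(1)])
  show "((\<lambda>t. (real ?k)\<^sup>2 * ((autocorr g (2 * n) 2 t - c) / t - 2 * ((autocorr g (2 * n + 1) 1 t - c) / t)))
    \<longlongrightarrow> (real ?k)\<^sup>2 * ((\<integral>x. matpow (g x) (2 * n) \<bullet> Y x \<partial>\<mu>) - 2 * (\<integral>x. matpow (g x) (2 * n + 1) \<bullet> X x \<partial>\<mu>))) (at_right 0)"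
    by (intro tendsto_intros lim XYZ) simp_all
  show "((\<lambda>t. - 2 * ((autocorr g ?k ?k t - c) / t)) \<longlongrightarrow> - 2 * (\<integral>x. matpow (g x) ?k \<bullet> Z x \<partial>\<mu>)) (at_right 0)"
    by (intro tendsto_intros lim Z) simp
  have "- 2 * ((autocorr g ?k ?k t - c) / t) \<le>
      (real ?k)\<^sup>2 * ((autocorr g (2 * n) 2 t - c) / t - 2 * ((autocorr g (2 * n + 1) 1 t - c) / t))" if "t > 0" for t
  proof -
    let ?s = "\<lambda>i j. autocorr g i j t"
    have "2 * (c - ?s ?k ?k) / t \<le> (real ?k)\<^sup>2 * (?s (2 * n) 2 - 2 * ?s (2 * n + 1) 1 + c) / t"
      using that autocorr_inequality[OF less_imp_le[OF that] herm L2, of n, folded c_def]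
      by (intro divide_right_mono) simp_all
    moreover have "2 * (c - a) / t = - 2 * ((a - c) / t)" for a
      by (simp add: diff_divide_distrib)
    moreover have "r * (a - 2 * b + c) / t = r * ((a - c) / t - 2 * ((b - c) / t))" for r a b
      using that by (simp add: field_simps)
    ultimately show ?thesis by simp
  qed
  then show "\<forall>\<^sub>F t in at_right 0. - 2 * ((autocorr g ?k ?k t - c) / t) \<le>
      (real ?k)\<^sup>2 * ((autocorr g (2 * n) 2 t - c) / t - 2 * ((autocorr g (2 * n + 1) 1 t - c) / t))"
    by (auto simp: eventually_at_filter intro!: always_eventually)
qed

text \<open>By \<open>inner_matpow_carre\<close> the limit is the carre du champ between two copies
  of the n-th power of g; its operator norm is then used column by column.\<close>

lemma dirichlet_matpow_le:
  fixes g :: "'a \<Rightarrow> complex^'n^'n" and n :: nat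
  assumes herm: "\<And>x. hermitian (g x)"
    and L2: "\<And>k. entries_in (\<lambda>x. matpow (g x) k) (L2 \<mu>)"
    and X: "mgenerates g X" and Y: "mgenerates (\<lambda>x. g x ** g x) Y"
    and Z: "mgenerates (\<lambda>x. matpow (g x) (Suc n)) Z"
    and v: "AE x in \<mu>. op_norm ((1 / 2) *\<^sub>R (Y x - g x ** X x - X x ** g x)) \<le> v"
  shows "- (\<integral>x. matpow (g x) (Suc n) \<bullet> Z x \<partial>\<mu>) \<le> v * (real (Suc n))\<^sup>2 * (\<integral>x. (norm (matpow (g x) n))\<^sup>2 \<partial>\<mu>)"
proof -
  have int: "integrable \<mu> (\<lambda>x. matpow (g x) k \<bullet> X x)" "integrable \<mu> (\<lambda>x. matpow (g x) k \<bullet> Y x)"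
     "integrable \<mu> (\<lambda>x. (norm (matpow (g x) k))\<^sup>2)" for k
    unfolding power2_norm_eq_inner by (intro entries_in_L2_inner L2 mgenerates_L2(2)[OF X] mgenerates_L2(2)[OF Y])+
  have "(\<integral>x. matpow (g x) (2 * n) \<bullet> Y x \<partial>\<mu>) - 2 * (\<integral>x. matpow (g x) (2 * n + 1) \<bullet> X x \<partial>\<mu>) =
      (\<integral>x. matpow (g x) (2 * n) \<bullet> Y x - 2 * (matpow (g x) (2 * n + 1) \<bullet> X x) \<partial>\<mu>)"
    using int by (simp del: matpow.simps(2))
  also have "\<dots> \<le> (\<integral>x. 2 * (v * (norm (matpow (g x) n))\<^sup>2) \<partial>\<mu>)"
  proof (rule integral_mono_AE)
    show "AE x in \<mu>. matpow (g x) (2 * n) \<bullet> Y x - 2 * (matpow (g x) (2 * n + 1) \<bullet> X x) \<le> 2 * (v * (norm (matpow (g x) n))\<^sup>2)"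
      using v unfolding inner_matpow_carre[OF herm]
      by eventually_elim (intro mult_left_mono inner_mult_le_columns inner_op_norm_le, auto)
  qed (use int in \<open>auto simp del: matpow.simps(2)\<close>)
  also have "\<dots> = 2 * v * (\<integral>x. (norm (matpow (g x) n))\<^sup>2 \<partial>\<mu>)" by simp
  finally have "(real (Suc n))\<^sup>2 * ((\<integral>x. matpow (g x) (2 * n) \<bullet> Y x \<partial>\<mu>) - 2 * (\<integral>x. matpow (g x) (2 * n + 1) \<bullet> X x \<partial>\<mu>))
      \<le> (real (Suc n))\<^sup>2 * (2 * v * (\<integral>x. (norm (matpow (g x) n))\<^sup>2 \<partial>\<mu>))"
    by (rule mult_left_mono) simp
  then have "- 2 * (\<integral>x. matpow (g x) (Suc n) \<bullet> Z x \<partial>\<mu>) \<le> (real (Suc n))\<^sup>2 * (2 * v * (\<integral>x. (norm (matpow (g x) n))\<^sup>2 \<partial>\<mu>))"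
    by (rule order_trans[OF dirichlet_matpow_inequality[OF herm L2 X Y Z]])
  moreover have "- a \<le> v * r * b" if "- 2 * a \<le> r * (2 * v * b)" for a r b :: real
    using that by (simp add: mult_ac)
  ultimately show ?thesis by blast
qed

end

section \<open>Moments and exponential tails\<close>

text \<open>The factor \<open>5 / 6\<close> pays for \<open>(2 k)! (2 k + 2)! > ((2 k + 1)!)\<^sup>2\<close> when odd moments are interpolated.\<close>

lemma moment_recursion_bound:
  fixes a :: "nat \<Rightarrow> real"
  assumes w: "0 \<le> w" and d: "0 \<le> d"
    and a0: "a 0 = d" and a1: "a 1 \<le> w * d"
    and rec: "\<And>j. a (Suc (Suc j)) \<le> w * (real (Suc (Suc j)))\<^sup>2 * a (Suc j) + w\<^sup>2 * (real (Suc j))\<^sup>2 * a j"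
  shows "a (Suc (Suc j)) \<le> 5 / 6 * (d * fact (2 * Suc (Suc j)) * (w / 2) ^ Suc (Suc j))"
proof -
  define b where "b k = d * fact (2 * k) * (w / 2) ^ k" for k
  have b_nonneg: "0 \<le> b k" for k using w d by (simp add: b_def)
  have b_Suc: "b (Suc k) = (2 * real k + 2) * (2 * real k + 1) * (w / 2) * b k" for k
    by (simp add: b_def mult_ac) (simp add: algebra_simps)
  \<comment> \<open>At j = 0 this is an equality, 5 w^2 d against b 2 = 6 w^2 d, which fixes the
    constant 5 / 6.\<close>
  have step: "w * (real (Suc (Suc j)))\<^sup>2 * b (Suc j) + w\<^sup>2 * (real (Suc j))\<^sup>2 * b j \<le> 5 / 6 * b (Suc (Suc j))" for j
  proof -
    define r where "r = real j"
    have r: "0 \<le> r" by (simp add: r_def)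
    have "5 / 6 * b (Suc (Suc j)) - (w * (real (Suc (Suc j)))\<^sup>2 * b (Suc j) + w\<^sup>2 * (real (Suc j))\<^sup>2 * b j) =
        w\<^sup>2 * b j * (r + 1) * (8 * r ^ 3 + 26 * r\<^sup>2 + 17 * r) / 6"
      by (simp add: b_Suc r_def[symmetric]) (simp add: power2_eq_square power3_eq_cube field_simps)
    also have "0 \<le> \<dots>" using r b_nonneg[of j] by simp
    finally show ?thesis by simp
  qed
  have le: "a j \<le> b j \<and> a (Suc j) \<le> b (Suc j)" for j
  proof (induction j)
    case 0
    show ?case using a0 a1 by (simp add: b_def mult.commute)
  next
    case (Suc j)
    have "a (Suc (Suc j)) \<le> w * (real (Suc (Suc j)))\<^sup>2 * b (Suc j) + w\<^sup>2 * (real (Suc j))\<^sup>2 * b j"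
      using Suc w by (intro order_trans[OF rec] add_mono mult_left_mono) auto
    also note step
    also have "5 / 6 * b (Suc (Suc j)) \<le> b (Suc (Suc j))" using b_nonneg by simp
    finally show ?case using Suc by simp
  qed
  have "a (Suc (Suc j)) \<le> w * (real (Suc (Suc j)))\<^sup>2 * b (Suc j) + w\<^sup>2 * (real (Suc j))\<^sup>2 * b j"
    using le[of j] w by (intro order_trans[OF rec] add_mono mult_left_mono) auto
  also note step
  finally show ?thesis by (simp only: b_def)
qed

lemma sum_exp_coefficients: "(\<Sum>i\<le>n. (x ^ i / fact i) * (x ^ (n - i) / fact (n - i))) = (2 * x) ^ n / fact n"
  for x :: real
proof -
  have "(2 * x) ^ n = (x + x) ^ n" by simp
  also have "\<dots> = (\<Sum>i\<le>n. real (n choose i) * x ^ i * x ^ (n - i))"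
    by (rule binomial_ring)
  also have "\<dots> / fact n = (\<Sum>i\<le>n. (x ^ i / fact i) * (x ^ (n - i) / fact (n - i)))"
    unfolding sum_divide_distrib
    by (intro sum.cong refl) (simp add: binomial_fact)
  finally show ?thesis ..
qed

text \<open>For M n the n-th trace moment of g, the left side is the second moment of the
  exponential series of \<theta> g / 2 cut off at N. The bound is uniform in N.\<close>

lemma exp_polynomial_moment_bound:
  fixes M :: "nat \<Rightarrow> real"
  assumes d: "0 \<le> d" and s: "0 \<le> s" and \<theta>: "0 \<le> \<theta>" and y: "\<theta> * s < 1"
    and M0: "M 0 \<le> d" and M1: "M 1 \<le> 0" and M2: "\<And>n. 2 \<le> n \<Longrightarrow> M n \<le> d * fact n * s ^ n"
  shows "(\<Sum>i\<le>N. \<Sum>j\<le>N. ((\<theta> / 2) ^ i / fact i) * ((\<theta> / 2) ^ j / fact j) * M (i + j)) \<le>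
    d * exp ((\<theta> * s)\<^sup>2 / (1 - \<theta> * s))"
proof -
  \<comment> \<open>Odd moments may be negative. The majorant \<open>B\<close> is not, so the index
    square can be enlarged to the triangle i + j \<le> 2 N. Its value 0 at n = 1 makes the resulting
    geometric series start at y^2.\<close>
  define B where "B n = (if n = 0 then d else if n = 1 then 0 else d * fact n * s ^ n)" for n :: nat
  define c where "c i = (\<theta> / 2) ^ i / fact i" for i :: nat
  define y where "y = \<theta> * s"
  have y01: "0 \<le> y" "y < 1" using assms by (auto simp: y_def)
  have MB: "M n \<le> B n" for n
    using M0 M1 M2[of n] by (auto simp: B_def)
  have B: "0 \<le> B n" for n using d s by (simp add: B_def)
  have c: "0 \<le> c i" for i using \<theta> by (simp add: c_def)
  have "(\<Sum>i\<le>N. \<Sum>j\<le>N. c i * c j * M (i + j)) \<le> (\<Sum>i\<le>N. \<Sum>j\<le>N. c i * c j * B (i + j))"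
    by (intro sum_mono mult_left_mono MB mult_nonneg_nonneg c)
  also have "\<dots> = (\<Sum>(i, j)\<in>{..N} \<times> {..N}. c i * c j * B (i + j))"
    by (simp add: sum.cartesian_product)
  also have "\<dots> \<le> (\<Sum>(i, j)\<in>{(i, j). i + j \<le> 2 * N}. c i * c j * B (i + j))"
  proof (rule sum_mono2)
    have "{(i, j). i + j \<le> 2 * N} \<subseteq> {..2 * N} \<times> {..2 * N}" by auto
    then show "finite {(i, j). i + j \<le> 2 * N}" by (rule finite_subset) simp
  qed (auto intro!: mult_nonneg_nonneg c B)
  also have "\<dots> = (\<Sum>n\<le>2 * N. \<Sum>i\<le>n. c i * c (n - i) * B (i + (n - i)))"
    by (rule sum.triangle_reindex_eq)
  also have "\<dots> = (\<Sum>n\<le>2 * N. \<theta> ^ n / fact n * B n)"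
  proof (intro sum.cong refl)
    fix n
    have "(\<Sum>i\<le>n. c i * c (n - i) * B (i + (n - i))) = (\<Sum>i\<le>n. c i * c (n - i)) * B n"
      by (simp add: sum_distrib_right)
    also have "(\<Sum>i\<le>n. c i * c (n - i)) = \<theta> ^ n / fact n"
      unfolding c_def sum_exp_coefficients by simp
    finally show "(\<Sum>i\<le>n. c i * c (n - i) * B (i + (n - i))) = \<theta> ^ n / fact n * B n" .
  qed
  also have "\<dots> \<le> d * (1 + y\<^sup>2 / (1 - y))"
  proof -
    \<comment> \<open>Carrying the remainder of the geometric series along turns the bound into an
      identity.\<close>
    have part: "(\<Sum>n\<le>Suc m. \<theta> ^ n / fact n * B n) + d * y ^ Suc (Suc m) / (1 - y) = d * (1 + y\<^sup>2 / (1 - y))" for m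
    proof (induction m)
      case 0
      then show ?case by (simp add: B_def power2_eq_square algebra_simps)
    next
      case (Suc m)
      have "\<theta> ^ Suc (Suc m) / fact (Suc (Suc m)) * B (Suc (Suc m)) = d * y ^ Suc (Suc m)"
        by (simp add: B_def y_def power_mult_distrib del: power_Suc fact_Suc)
      moreover have "d * z + d * (y * z) / (1 - y) = d * z / (1 - y)" for z
        using y01 by (simp add: field_simps)
      then have "d * y ^ Suc (Suc m) + d * y ^ Suc (Suc (Suc m)) / (1 - y) = d * y ^ Suc (Suc m) / (1 - y)"
        by simp
      ultimately show ?case using Suc by simp
    qed
    show ?thesis
    proof (cases N)
      case 0
      then show ?thesis using d y01 by (simp add: B_def algebra_simps)
    next
      case (Suc m)
      have "0 \<le> d * y ^ Suc (Suc (Suc (2 * m))) / (1 - y)" using y01 d by simp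
      with part[of "Suc (2 * m)"] show ?thesis by (simp add: Suc)
    qed
  qed
  also have "\<dots> \<le> d * exp (y\<^sup>2 / (1 - y))"
    by (intro mult_left_mono exp_ge_add_one_self d)
  finally show ?thesis unfolding c_def y_def .
qed

text \<open>The classical choice in Bernstein's inequality, not the exact minimiser: it gives
  \<theta> s = t / (2 s + t), and then the first term of the exponent is exactly half of \<theta>
  t.\<close>

lemma bernstein_exponent:
  fixes t w :: real
  assumes "0 < w" "0 \<le> t"
  defines "s \<equiv> sqrt (w / 2)"
  defines "\<theta> \<equiv> t / (w + t * s)"
  shows "0 \<le> \<theta>" "\<theta> * s < 1"
    "(\<theta> * s)\<^sup>2 / (1 - \<theta> * s) - \<theta> * t = - (t\<^sup>2 / (2 * w + t * sqrt (2 * w)))"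
proof -
  have s: "0 < s" and w: "w = 2 * s\<^sup>2"
    using assms by (simp_all add: s_def)
  have "(2 * s)\<^sup>2 = 2 * w" using w by (simp add: power2_eq_square)
  then have sq: "sqrt (2 * w) = 2 * s"
    using s by (metis abs_of_pos real_sqrt_abs mult_pos_pos zero_less_numeral)
  have th: "\<theta> * s = t / (2 * s + t)"
  proof -
    have "w + t * s = s * (2 * s + t)" by (simp add: w power2_eq_square algebra_simps)
    then show ?thesis using s by (simp add: \<theta>_def)
  qed
  have pos: "0 < 2 * s + t" using s assms(2) by simp
  show "0 \<le> \<theta>" using assms s by (simp add: \<theta>_def)
  show "\<theta> * s < 1" unfolding th using s assms(2) by simp
  have 1: "1 - t / (2 * s + t) = 2 * s / (2 * s + t)" using pos by (simp add: field_simps)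
  have 2: "\<theta> * t = t\<^sup>2 / (s * (2 * s + t))"
  proof -
    have "w + t * s = s * (2 * s + t)" by (simp add: w power2_eq_square algebra_simps)
    then show ?thesis by (simp add: \<theta>_def power2_eq_square)
  qed
  have "(t / p)\<^sup>2 / (2 * s / p) = t\<^sup>2 / (2 * s * p)" if "0 < p" for p
    using s that by (simp add: power2_eq_square)
  note 3 = this[OF pos]
  have 4: "2 * w + t * sqrt (2 * w) = 2 * s * (2 * s + t)"
    unfolding sq by (simp add: w power2_eq_square algebra_simps)
  show "(\<theta> * s)\<^sup>2 / (1 - \<theta> * s) - \<theta> * t = - (t\<^sup>2 / (2 * w + t * sqrt (2 * w)))"
  proof -
    have "t\<^sup>2 / (2 * s * p) - t\<^sup>2 / (s * p) = - (t\<^sup>2 / (2 * s * p))" for p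
      by (cases "p = 0") (use s in \<open>simp_all add: field_simps\<close>)
    then show ?thesis unfolding 2 4 unfolding th 1 3 .
  qed
qed

section \<open>Consequences of a matrix Poincare inequality\<close>

lemma hermitian_mexpectation:
  assumes "\<And>x. hermitian (F x)"
  shows "hermitian (mexpectation M F)"
proof -
  have "cnj (\<integral>x. F x $ j $ i \<partial>M) = (\<integral>x. cnj (F x $ j $ i) \<partial>M)" for i j
    by simp
  then have "cnj (\<integral>x. F x $ j $ i \<partial>M) = (\<integral>x. F x $ i $ j \<partial>M)" for i j
    by (simp only: hermitian_nth[OF assms])
  then show ?thesis
    by (simp add: hermitian_def vec_eq_iff adjoint_matrix_nth mexpectation_def)
qed

text \<open>No bound on the carre du champ is assumed here, so that \<alpha> \<le> 0 can be settled
  even if the essential supremum is infinite.\<close>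

locale poincare_powers = reversible_kernels \<mu> K P for \<mu> :: "'a measure" and K P +
  fixes g :: "'a \<Rightarrow> complex^'n^'n" and \<alpha> :: real
  assumes herm: "\<And>x. hermitian (g x)"
    and domain: "\<And>k. entries_in (\<lambda>x. matpow (g x) k) (gen_domain \<mu> P)"
    and mean: "mexpectation \<mu> g = 0"
    and poincare: "\<And>F :: 'a \<Rightarrow> complex^'n^'n. (\<And>x. hermitian (F x)) \<Longrightarrow> entries_in F (gen_domain \<mu> P) \<Longrightarrow>
      mvariance \<mu> F \<preceq> \<alpha> *\<^sub>R dirichlet_form \<mu> P F"
begin

definition even_moment :: "nat \<Rightarrow> real" where
  "even_moment k = (\<integral>x. (norm (matpow (g x) k))\<^sup>2 \<partial>\<mu>)"

definition mean_pow :: "nat \<Rightarrow> complex^'n^'n" where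
  "mean_pow k = mexpectation \<mu> (\<lambda>x. matpow (g x) k)"

lemma herm_pow: "hermitian (matpow (g x) k)"
  by (rule hermitian_matpow[OF herm])

lemma L2_pow: "entries_in (\<lambda>x. matpow (g x) k) (L2 \<mu>)"
  using mgenerates_L2(1)[OF mgenerates_mgenerator[OF domain]] .

lemma integrable_pow: "integrable \<mu> (\<lambda>x. matpow (g x) k $ i $ j)"
  using L2_pow L2_integrable by (auto simp: entries_in_def)

lemma inner_mean_pow: "A \<bullet> mean_pow k = (\<integral>x. A \<bullet> matpow (g x) k \<partial>\<mu>)" and integrable_inner: "integrable \<mu> (\<lambda>x. A \<bullet> matpow (g x) k)"
  unfolding mean_pow_def using entries_integrable_inner_const[where M = \<mu> and G = "\<lambda>x. matpow (g x) k" and A = A, OF integrable_pow] by auto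

lemma mean_pow_1: "mean_pow 1 = 0"
  using mean by (simp add: mean_pow_def)

lemma hermitian_mean_pow: "hermitian (mean_pow k)"
  unfolding mean_pow_def by (rule hermitian_mexpectation[OF herm_pow])

lemma integrable_pow_inner: "integrable \<mu> (\<lambda>x. matpow (g x) i \<bullet> matpow (g x) j)"
  by (rule entries_in_L2_inner(1)[OF L2_pow L2_pow])

lemma even_moment_nonneg: "0 \<le> even_moment k"
  by (simp add: even_moment_def)

lemma even_moment_0: "even_moment 0 = real CARD('n)"
proof -
  have "mat 1 \<bullet> (mat 1 :: complex^'n^'n) = real CARD('n)"
    using Re_trace_mult_hermitian[OF hermitian_mat_1, of "mat 1 :: complex^'n^'n"] by (simp add: trace_I)
  then show ?thesis by (simp add: even_moment_def power2_norm_eq_inner prob_space)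
qed

lemma Re_trace_variance: "Re (trace (mvariance \<mu> (\<lambda>x. matpow (g x) k))) = even_moment k - (norm (mean_pow k))\<^sup>2"
  using Re_trace_mexpectation_mult[OF herm_pow L2_pow L2_pow, of k k] Re_trace_mult_hermitian[OF hermitian_mean_pow, of k "mean_pow k"]
  unfolding mvariance_def trace_sub mean_pow_def[symmetric]
  by (simp add: even_moment_def power2_norm_eq_inner)

definition energy :: "nat \<Rightarrow> real" where
  "energy k = - (\<integral>x. matpow (g x) k \<bullet> mgenerator \<mu> P (\<lambda>x. matpow (g x) k) x \<partial>\<mu>)"

lemma Re_trace_dirichlet: "Re (trace (dirichlet_form \<mu> P (\<lambda>x. matpow (g x) k))) = energy k"
proof -
  have "trace (- A) = - trace A" for A :: "complex^'n^'n"
    by (simp add: trace_def sum_negf)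
  then show ?thesis
    unfolding dirichlet_form_def energy_def
    using Re_trace_mexpectation_mult[OF herm_pow L2_pow mgenerates_L2(2)[OF mgenerates_mgenerator[OF domain]], of k k]
    by simp
qed

lemma variance_le_energy: "even_moment k - (norm (mean_pow k))\<^sup>2 \<le> \<alpha> * energy k"
proof -
  have "0 \<le> Re (trace (\<alpha> *\<^sub>R dirichlet_form \<mu> P (\<lambda>x. matpow (g x) k) - mvariance \<mu> (\<lambda>x. matpow (g x) k)))"
    using poincare[OF herm_pow domain, of k] unfolding psd_le_def by (rule Re_trace_psd_nonneg)
  moreover have "Re (trace (\<alpha> *\<^sub>R A)) = \<alpha> * Re (trace A)" for A :: "complex^'n^'n"
    by (simp add: trace_def sum_distrib_left)
  ultimately show ?thesis
    by (simp add: trace_sub Re_trace_variance Re_trace_dirichlet)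
qed

lemma energy_nonneg: "0 \<le> energy k"
proof -
  have "Re (\<integral>x. cnj (matpow (g x) k $ i $ j) * mgenerator \<mu> P (\<lambda>x. matpow (g x) k) x $ i $ j \<partial>\<mu>) \<le> 0" for i j
    using mgenerates_mgenerator[OF domain, of k] unfolding mgenerates_def by (intro generator_nonpos) blast
  then show ?thesis
    unfolding energy_def entries_in_L2_inner(2)[OF L2_pow mgenerates_L2(2)[OF mgenerates_mgenerator[OF domain]]]
    by (simp add: sum_nonpos)
qed

lemma quadratic_form_mexpectation_le:
  fixes H :: "'a \<Rightarrow> complex^'n^'n"
  assumes int: "\<And>i j. integrable \<mu> (\<lambda>x. H x $ i $ j)" and le: "AE x in \<mu>. op_norm (H x) \<le> c"
  shows "x \<bullet> (mexpectation \<mu> H *v x) \<le> c * (norm x)\<^sup>2"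
proof -
  have i: "integrable \<mu> (\<lambda>z. cnj (x $ i) * (H z $ i $ j * x $ j))" for i j
    using int by simp
  have j: "integrable \<mu> (\<lambda>z. \<Sum>i\<in>UNIV. \<Sum>j\<in>UNIV. cnj (x $ i) * (H z $ i $ j * x $ j))"
    by (intro Bochner_Integration.integrable_sum i)
  have quad: "x \<bullet> (B *v x) = Re (\<Sum>i\<in>UNIV. \<Sum>j\<in>UNIV. cnj (x $ i) * (B $ i $ j * x $ j))" for B
    by (simp add: inner_complex_vector matrix_vector_mult_def sum_distrib_left)
  have "x \<bullet> (mexpectation \<mu> H *v x) = (\<integral>z. x \<bullet> (H z *v x) \<partial>\<mu>)"
    unfolding quad integral_Re[OF j] using i int by (simp add: mexpectation_def)
  also have "\<dots> \<le> (\<integral>z. c * (norm x)\<^sup>2 \<partial>\<mu>)"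
  proof (rule integral_mono_AE)
    show "integrable \<mu> (\<lambda>z. x \<bullet> (H z *v x))" unfolding quad by (rule integrable_Re[OF j])
    show "AE z in \<mu>. x \<bullet> (H z *v x) \<le> c * (norm x)\<^sup>2"
      using le by eventually_elim (rule inner_op_norm_le)
  qed simp
  finally show ?thesis by (simp add: prob_space)
qed

lemma integral_variance:
  "(\<integral>x. (norm (matpow (g x) k - mean_pow k))\<^sup>2 \<partial>\<mu>) = even_moment k - (norm (mean_pow k))\<^sup>2"
proof -
  have "(\<integral>x. (norm (matpow (g x) k - mean_pow k))\<^sup>2 \<partial>\<mu>) =
      (\<integral>x. (norm (matpow (g x) k))\<^sup>2 - 2 * (mean_pow k \<bullet> matpow (g x) k) + (norm (mean_pow k))\<^sup>2 \<partial>\<mu>)"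
    unfolding power2_norm_eq_inner
    by (simp add: inner_diff_left inner_diff_right inner_commute[of "matpow _ k" "mean_pow k"] algebra_simps)
  also have "\<dots> = even_moment k - 2 * (\<integral>x. mean_pow k \<bullet> matpow (g x) k \<partial>\<mu>) + (norm (mean_pow k))\<^sup>2"
    using integrable_pow_inner[of k k] integrable_inner[of "mean_pow k" k]
    by (simp add: even_moment_def power2_norm_eq_inner prob_space)
  also have "\<dots> = even_moment k - (norm (mean_pow k))\<^sup>2"
    unfolding inner_mean_pow[symmetric] by (simp add: power2_norm_eq_inner)
  finally show ?thesis .
qed

lemma variance_nonneg: "0 \<le> even_moment k - (norm (mean_pow k))\<^sup>2"
  unfolding integral_variance[symmetric] by simp

text \<open>Centring the second factor leaves a variance instead of a full moment, and the Poincare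
  inequality bounds a variance without remainder.\<close>

lemma inner_mean_square_le:
  assumes F: "entries_in F (L2 \<mu>)"
  shows "(\<integral>x. F x \<bullet> (matpow (g x) k - mean_pow k) \<partial>\<mu>)\<^sup>2 \<le> (\<integral>x. (norm (F x))\<^sup>2 \<partial>\<mu>) * (even_moment k - (norm (mean_pow k))\<^sup>2)"
proof -
  have GL2: "entries_in (\<lambda>x. matpow (g x) k - mean_pow k) (L2 \<mu>)"
    using L2_pow[of k] by (auto simp: entries_in_def intro!: L2_diff L2_const)
  note i = entries_in_L2_inner(1)[OF F F] entries_in_L2_inner(1)[OF GL2 GL2] entries_in_L2_inner(1)[OF F GL2]
  have meas: "(\<lambda>x. norm (F x)) \<in> borel_measurable \<mu>" "(\<lambda>x. norm (matpow (g x) k - mean_pow k)) \<in> borel_measurable \<mu>"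
    unfolding norm_eq_sqrt_inner using borel_measurable_integrable[OF i(1)] borel_measurable_integrable[OF i(2)]
    by simp_all
  have "\<bar>\<integral>x. F x \<bullet> (matpow (g x) k - mean_pow k) \<partial>\<mu>\<bar> \<le> (\<integral>x. norm (F x) * norm (matpow (g x) k - mean_pow k) \<partial>\<mu>)"
  proof -
    have "integrable \<mu> (\<lambda>x. norm (F x) * norm (matpow (g x) k - mean_pow k))"
      using i by (intro integral_Cauchy_Schwarz(1)[OF meas]) (simp_all add: power2_norm_eq_inner)
    then show ?thesis
      using i by (intro order_trans[OF integral_abs_bound] integral_mono) (auto simp: Cauchy_Schwarz_ineq2)
  qed
  then have "(\<integral>x. F x \<bullet> (matpow (g x) k - mean_pow k) \<partial>\<mu>)\<^sup>2 \<le> (\<integral>x. norm (F x) * norm (matpow (g x) k - mean_pow k) \<partial>\<mu>)\<^sup>2"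
    by (rule power2_le_iff_abs_le[THEN iffD2, rotated]) simp
  also have "\<dots> \<le> (\<integral>x. (norm (F x))\<^sup>2 \<partial>\<mu>) * (\<integral>x. (norm (matpow (g x) k - mean_pow k))\<^sup>2 \<partial>\<mu>)"
    using i by (intro integral_Cauchy_Schwarz(2)[OF meas]) (simp_all add: power2_norm_eq_inner)
  finally show ?thesis unfolding integral_variance .
qed

section \<open>Trace moments and the degenerate case\<close>

definition trace_moment :: "nat \<Rightarrow> real" where
  "trace_moment n = (\<integral>x. mat 1 \<bullet> matpow (g x) n \<partial>\<mu>)"

lemma trace_moment_add: "trace_moment (i + j) = (\<integral>x. matpow (g x) i \<bullet> matpow (g x) j \<partial>\<mu>)"
  using inner_matpow_eq[OF herm, of 0 "i + j" i j] by (simp add: trace_moment_def)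

lemma trace_moment_double: "trace_moment (2 * k) = even_moment k"
  unfolding mult_2 trace_moment_add even_moment_def power2_norm_eq_inner ..

lemma trace_moment_1: "trace_moment 1 = 0"
  unfolding trace_moment_def inner_mean_pow[symmetric] mean_pow_1 by simp

lemma trace_moment_odd_squared_le: "(trace_moment (Suc (2 * k)))\<^sup>2 \<le> even_moment k * even_moment (Suc k)"
proof -
  have meas: "(\<lambda>x. norm (matpow (g x) k)) \<in> borel_measurable \<mu>" for k
    unfolding norm_eq_sqrt_inner using borel_measurable_integrable[OF integrable_pow_inner[of k k]] by simp
  have i: "integrable \<mu> (\<lambda>x. (norm (matpow (g x) k))\<^sup>2)" for k
    unfolding power2_norm_eq_inner by (rule integrable_pow_inner)
  have "\<bar>trace_moment (k + Suc k)\<bar> \<le> (\<integral>x. norm (matpow (g x) k) * norm (matpow (g x) (Suc k)) \<partial>\<mu>)"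
    unfolding trace_moment_add
    by (intro order_trans[OF integral_abs_bound] integral_mono integrable_abs integrable_pow_inner
        integral_Cauchy_Schwarz(1) meas i Cauchy_Schwarz_ineq2)
  then have "(trace_moment (k + Suc k))\<^sup>2 \<le> (\<integral>x. norm (matpow (g x) k) * norm (matpow (g x) (Suc k)) \<partial>\<mu>)\<^sup>2"
    by (rule power2_le_iff_abs_le[THEN iffD2, rotated]) simp
  also have "\<dots> \<le> even_moment k * even_moment (Suc k)"
    unfolding even_moment_def by (intro integral_Cauchy_Schwarz(2) meas i)
  finally show ?thesis by (simp add: mult_2)
qed

text \<open>As g has mean 0, the mean of its square can be subtracted for free. With w = \<alpha> v,
  interpolation between even moments would give only 5 w^3 d^2, while 9 / 2 w^3 d^2 is
  required.\<close>

lemma trace_moment_3_squared_le: "(trace_moment 3)\<^sup>2 \<le> even_moment 1 * (even_moment 2 - (norm (mean_pow 2))\<^sup>2)"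
proof -
  have "trace_moment (1 + 2) = (\<integral>x. matpow (g x) 1 \<bullet> (matpow (g x) 2 - mean_pow 2) \<partial>\<mu>)"
    using integrable_pow_inner[of 1 2] integrable_inner[of "mean_pow 2" 1] inner_mean_pow[of "mean_pow 2" 1] mean_pow_1
    unfolding trace_moment_add by (simp add: inner_diff_right inner_commute[of _ "mean_pow 2"])
  then show ?thesis
    using inner_mean_square_le[OF L2_pow, of 1 2] by (simp add: even_moment_def numeral_3_eq_3)
qed

text \<open>The energy is nonnegative, so a nonpositive Poincare constant leaves no room for any
  variance.\<close>

lemma even_moment_1_nonpos: "\<alpha> \<le> 0 \<Longrightarrow> even_moment 1 \<le> 0"
  using variance_le_energy[of 1] mean_pow_1 mult_nonpos_nonneg[OF _ energy_nonneg, of \<alpha> 1] by simp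

lemma degenerate_tail:
  assumes "even_moment 1 \<le> 0" and t: "0 < t"
  shows "measure \<mu> {x \<in> space \<mu>. t \<le> lambda_max (g x)} = 0"
proof -
  have "even_moment 1 = 0" using assms(1) even_moment_nonneg[of 1] by simp
  moreover have int: "integrable \<mu> (\<lambda>x. (norm (g x))\<^sup>2)"
    using integrable_pow_inner[of 1 1] by (simp add: power2_norm_eq_inner)
  ultimately have AE: "AE x in \<mu>. g x = 0"
    using integral_nonneg_eq_0_iff_AE[OF int] by (simp add: even_moment_def)
  have "AE x in \<mu>. \<not> t \<le> lambda_max (g x)"
    using AE
  proof eventually_elim
    case (elim x)
    obtain u where u: "u \<noteq> 0" "g x *v u = complex_of_real (lambda_max (g x)) *s u"
      using lambda_max_eigenvector[OF herm] .
    then have "lambda_max (g x) *\<^sub>R u = 0"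
      by (simp add: elim of_real_smult)
    with u(1) t show ?case by simp
  qed
  \<comment> \<open>Measurability of the tail event is not established; a measurable null set
    containing it is enough.\<close>
  then obtain N where N: "{x \<in> space \<mu>. \<not> \<not> t \<le> lambda_max (g x)} \<subseteq> N" "emeasure \<mu> N = 0" "N \<in> sets \<mu>"
    by (rule AE_E)
  have "measure \<mu> {x \<in> space \<mu>. t \<le> lambda_max (g x)} \<le> measure \<mu> N"
    by (rule finite_measure_mono) (use N in auto)
  also have "\<dots> = 0" using N(2) by (simp add: measure_def)
  finally show ?thesis by (simp add: measure_le_0_iff)
qed


end

text \<open>The derivatives \<open>X\<close> and \<open>Y\<close> are parameters: for a centred
  function they can be taken from the uncentred one by linearity, and then the bracket is its carre
  du champ at every point.\<close>

locale poincare_bounded_carre = poincare_powers \<mu> K P g \<alpha>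
  for \<mu> :: "'a measure" and K P and g :: "'a \<Rightarrow> complex^'n^'n" and \<alpha> +
  fixes X Y :: "'a \<Rightarrow> complex^'n^'n" and v :: real
  assumes X: "mgenerates g X" and Y: "mgenerates (\<lambda>x. g x ** g x) Y"
    and carre: "AE x in \<mu>. op_norm ((1 / 2) *\<^sub>R (Y x - g x ** X x - X x ** g x)) \<le> v"
begin

lemma energy_le: "energy (Suc n) \<le> v * (real (Suc n))\<^sup>2 * even_moment n"
  unfolding energy_def even_moment_def
  by (rule dirichlet_matpow_le[OF herm L2_pow X Y mgenerates_mgenerator[OF domain] carre])

lemma carre_entries_integrable:
  "integrable \<mu> (\<lambda>x. ((1 / 2) *\<^sub>R (Y x - g x ** X x - X x ** g x)) $ i $ j)"
proof -
  have g: "entries_in g (L2 \<mu>)" by (rule mgenerates_L2(1)[OF X])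
  have "integrable \<mu> (\<lambda>x. Y x $ i $ j)"
    using mgenerates_L2(2)[OF Y] L2_integrable by (auto simp: entries_in_def)
  then show ?thesis
    using integrable_mult_entries[OF g mgenerates_L2(2)[OF X], of i j]
      integrable_mult_entries[OF mgenerates_L2(2)[OF X] g, of i j]
    by simp
qed

text \<open>The generator of the square has mean 0, and entrywise symmetry gives
  \<open>g x ** X x\<close> and \<open>X x ** g x\<close> the same expectation although they do not
  commute.\<close>

lemma dirichlet_form_eq_carre:
  "dirichlet_form \<mu> P g = mexpectation \<mu> (\<lambda>x. (1 / 2) *\<^sub>R (Y x - g x ** X x - X x ** g x))"
proof -
  have g: "entries_in g (L2 \<mu>)" and gen: "mgenerates g (mgenerator \<mu> P g)"
    using mgenerates_L2(1)[OF X] mgenerates_mgenerator[of g] domain[of 1] by simp_all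
  have gX: "mexpectation \<mu> (\<lambda>x. g x ** X x) $ i $ j = mexpectation \<mu> (\<lambda>x. g x ** mgenerator \<mu> P g x) $ i $ j" for i j
    unfolding mexpectation_mult_nth[OF g mgenerates_L2(2)[OF X]] mexpectation_mult_nth[OF g mgenerates_L2(2)[OF gen]]
    using g X gen by (intro sum.cong refl pairing_generator_unique) (auto simp: entries_in_def mgenerates_def)
  have Xg: "mexpectation \<mu> (\<lambda>x. X x ** g x) $ i $ j = mexpectation \<mu> (\<lambda>x. g x ** X x) $ i $ j" for i j
    unfolding mexpectation_mult_nth[OF g mgenerates_L2(2)[OF X]] mexpectation_mult_nth[OF mgenerates_L2(2)[OF X] g]
    using X by (intro sum.cong refl generator_symmetric[symmetric]) (auto simp: mgenerates_def)
  have Y0: "mexpectation \<mu> Y $ i $ j = 0" for i j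
    using integral_generator[of "\<lambda>x. (g x ** g x) $ i $ j" "\<lambda>x. Y x $ i $ j"] Y
    by (simp add: mgenerates_def mexpectation_def)
  have Yi: "integrable \<mu> (\<lambda>x. Y x $ i $ j)" for i j
    using mgenerates_L2(2)[OF Y] L2_integrable by (auto simp: entries_in_def)
  have "mexpectation \<mu> (\<lambda>x. (1 / 2) *\<^sub>R (Y x - g x ** X x - X x ** g x)) $ i $ j =
    (1 / 2) *\<^sub>R (mexpectation \<mu> Y $ i $ j - mexpectation \<mu> (\<lambda>x. g x ** X x) $ i $ j - mexpectation \<mu> (\<lambda>x. X x ** g x) $ i $ j)" for i j
    using Yi[of i j] integrable_mult_entries[OF g mgenerates_L2(2)[OF X], of i j]
      integrable_mult_entries[OF mgenerates_L2(2)[OF X] g, of i j]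
    by (simp add: mexpectation_def)
  then show ?thesis
    by (simp add: vec_eq_iff dirichlet_form_def Xg gX Y0)
qed

text \<open>The matrix inequality is essential here: its trace would lose a factor \<open>d\<close>.\<close>

lemma second_moment_le:
  assumes "0 \<le> \<alpha>"
  shows "x \<bullet> (mean_pow 2 *v x) \<le> \<alpha> * v * (norm x)\<^sup>2"
proof -
  have "mvariance \<mu> g = mean_pow 2"
    using mean by (simp add: mvariance_def mean_pow_def matpow_2)
  then have "psd (\<alpha> *\<^sub>R dirichlet_form \<mu> P g - mean_pow 2)"
    using poincare[of g] herm domain[of 1] by (simp add: psd_le_def)
  then have "0 \<le> x \<bullet> ((\<alpha> *\<^sub>R dirichlet_form \<mu> P g - mean_pow 2) *v x)"
    by (simp add: psd_def)
  moreover have "(\<alpha> *\<^sub>R B) *v x = \<alpha> *\<^sub>R (B *v x)" for B :: "complex^'n^'n"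
    by (simp add: vec_eq_iff matrix_vector_mult_def flip: scaleR_sum_right)
  ultimately have "x \<bullet> (mean_pow 2 *v x) \<le> \<alpha> * (x \<bullet> (dirichlet_form \<mu> P g *v x))"
    by (simp add: matrix_vector_mult_diff_rdistrib inner_diff_right)
  also have "\<dots> \<le> \<alpha> * (v * (norm x)\<^sup>2)"
    unfolding dirichlet_form_eq_carre
    by (intro mult_left_mono quadratic_form_mexpectation_le carre_entries_integrable carre assms)
  finally show ?thesis by (simp add: mult_ac)
qed

lemma v_nonneg: "0 \<le> v"
proof -
  have "AE x in \<mu>. 0 \<le> v"
    using carre by eventually_elim (use op_norm_nonneg order_trans in blast)
  then show ?thesis by (simp add: AE_const)
qed

text \<open>Testing the mean N against itself puts the fourth power of its norm on the left;
  \<open>second_moment_le\<close> leaves only the square on the right, and one square cancels. What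
  remains is a variance of lower order, open to the Poincare inequality again.\<close>

lemma mean_power_le:
  assumes \<alpha>: "0 \<le> \<alpha>"
  shows "(norm (mean_pow (Suc k)))\<^sup>2 \<le> \<alpha> * v * (even_moment k - (norm (mean_pow k))\<^sup>2)"
proof -
  define N where "N = mean_pow (Suc k)"
  have N: "hermitian N" unfolding N_def by (rule hermitian_mean_pow)
  have gN: "entries_in (\<lambda>x. g x ** N) (L2 \<mu>)"
    using L2_pow[of 1] unfolding entries_in_def matrix_matrix_mult_def
    by (auto intro!: L2_sum L2_cmult simp: mult.commute[of _ "N $ _ $ _"])
  have "N \<bullet> N = (\<integral>x. N \<bullet> matpow (g x) (Suc k) \<partial>\<mu>)"
    unfolding N_def by (rule inner_mean_pow)
  also have "\<dots> = (\<integral>x. (g x ** N) \<bullet> matpow (g x) k \<partial>\<mu>)"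
    by (simp add: inner_mult_hermitian_left[OF herm])
  also have "\<dots> = (\<integral>x. (g x ** N) \<bullet> (matpow (g x) k - mean_pow k) \<partial>\<mu>)"
  proof -
    have eq: "(g x ** N) \<bullet> mean_pow k = (mean_pow k ** N) \<bullet> matpow (g x) 1" for x
      using inner_mult_hermitian_right[OF N, of "g x" "mean_pow k"] by (simp add: inner_commute)
    \<comment> \<open>The subtracted mean only contributes a constant matrix paired with g.\<close>
    have "(\<integral>x. (g x ** N) \<bullet> mean_pow k \<partial>\<mu>) = 0"
      unfolding eq inner_mean_pow[symmetric] mean_pow_1 by simp
    moreover have "integrable \<mu> (\<lambda>x. (g x ** N) \<bullet> mean_pow k)"
      unfolding eq by (rule integrable_inner)
    ultimately show ?thesis
      using entries_in_L2_inner(1)[OF gN L2_pow, of k] by (simp add: inner_diff_right)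
  qed
  finally have "((norm N)\<^sup>2)\<^sup>2 = (\<integral>x. (g x ** N) \<bullet> (matpow (g x) k - mean_pow k) \<partial>\<mu>)\<^sup>2"
    by (simp add: power2_norm_eq_inner)
  also have "\<dots> \<le> (\<integral>x. (norm (g x ** N))\<^sup>2 \<partial>\<mu>) * (even_moment k - (norm (mean_pow k))\<^sup>2)"
    by (rule inner_mean_square_le[OF gN])
  also have "(\<integral>x. (norm (g x ** N))\<^sup>2 \<partial>\<mu>) = N \<bullet> (mean_pow 2 ** N)"
  proof -
    have "(norm (g x ** N))\<^sup>2 = (N ** N) \<bullet> matpow (g x) 2" for x
      using inner_mult_hermitian_left[OF herm, of x N "g x ** N"]
        inner_mult_hermitian_right[OF N, of N "matpow (g x) 2"]
      by (simp add: power2_norm_eq_inner matrix_mul_assoc matpow_2)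
    note norm_eq = this
    show ?thesis
      by (simp only: norm_eq inner_mean_pow[symmetric] inner_mult_hermitian_right[OF N, symmetric])
  qed
  finally have 1: "((norm N)\<^sup>2)\<^sup>2 \<le> N \<bullet> (mean_pow 2 ** N) * (even_moment k - (norm (mean_pow k))\<^sup>2)" .
  have "N \<bullet> (mean_pow 2 ** N) \<le> \<alpha> * v * (norm N)\<^sup>2"
    by (rule inner_mult_le_columns[OF second_moment_le[OF \<alpha>]])
  from order_trans[OF 1 mult_right_mono[OF this variance_nonneg]]
  have *: "(norm N)\<^sup>2 * (norm N)\<^sup>2 \<le> (norm N)\<^sup>2 * (\<alpha> * v * (even_moment k - (norm (mean_pow k))\<^sup>2))"
    by (simp add: power2_eq_square mult_ac)
  \<comment> \<open>Needed for N = 0, where nothing can be cancelled.\<close>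
  have "0 \<le> \<alpha> * v * (even_moment k - (norm (mean_pow k))\<^sup>2)"
    by (intro mult_nonneg_nonneg \<alpha> v_nonneg variance_nonneg)
  then show ?thesis
    unfolding N_def[symmetric] using mult_left_le_imp_le[OF *] by (cases "N = 0") simp_all
qed

section \<open>Moment recursion and tail bound\<close>

lemma variance_power_le:
  assumes "0 \<le> \<alpha>"
  shows "even_moment (Suc k) - (norm (mean_pow (Suc k)))\<^sup>2 \<le> \<alpha> * v * (real (Suc k))\<^sup>2 * even_moment k"
  using order_trans[OF variance_le_energy mult_left_mono[OF energy_le assms]] by (simp only: mult.assoc)

lemma even_moment_1_le: "0 \<le> \<alpha> \<Longrightarrow> even_moment 1 \<le> \<alpha> * v * real CARD('n)"
  using variance_power_le[of 0] mean_pow_1 by (simp add: even_moment_0)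

text \<open>The Poincare inequality enters twice: for the variance at level j + 2, and at level j +
  1 after \<open>mean_power_le\<close> has traded the squared mean for a variance one level
  lower.\<close>

lemma even_moment_recursion:
  assumes \<alpha>: "0 \<le> \<alpha>"
  shows "even_moment (Suc (Suc j)) \<le> \<alpha> * v * (real (Suc (Suc j)))\<^sup>2 * even_moment (Suc j) + (\<alpha> * v)\<^sup>2 * (real (Suc j))\<^sup>2 * even_moment j"
proof -
  have w: "0 \<le> \<alpha> * v" using \<alpha> v_nonneg by simp
  have "even_moment (Suc (Suc j)) \<le> \<alpha> * v * (real (Suc (Suc j)))\<^sup>2 * even_moment (Suc j) + (norm (mean_pow (Suc (Suc j))))\<^sup>2"
    using variance_power_le[OF \<alpha>, of "Suc j"] by simp
  also have "(norm (mean_pow (Suc (Suc j))))\<^sup>2 \<le> \<alpha> * v * (even_moment (Suc j) - (norm (mean_pow (Suc j)))\<^sup>2)"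
    by (rule mean_power_le[OF \<alpha>])
  also have "\<dots> \<le> \<alpha> * v * (\<alpha> * v * (real (Suc j))\<^sup>2 * even_moment j)"
    by (rule mult_left_mono[OF variance_power_le[OF \<alpha>] w])
  finally show ?thesis by (simp only: power2_eq_square mult.assoc)
qed

lemma moment_bound:
  assumes \<alpha>: "0 \<le> \<alpha>" and n: "2 \<le> n"
  shows "trace_moment n \<le> real CARD('n) * fact n * sqrt (\<alpha> * v / 2) ^ n"
proof -
  define w where "w = \<alpha> * v"
  define d where "d = real CARD('n)"
  define s where "s = sqrt (w / 2)"
  have w: "0 \<le> w" using \<alpha> v_nonneg by (simp add: w_def)
  have s: "0 \<le> s" "s\<^sup>2 = w / 2" using w by (simp_all add: s_def)
  have d: "0 \<le> d" by (simp add: d_def)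
  define b where "b k = d * fact (2 * k) * (w / 2) ^ k" for k
  have b_nonneg: "0 \<le> b k" for k using w d by (simp add: b_def)
  have strong: "even_moment (Suc (Suc j)) \<le> 5 / 6 * b (Suc (Suc j))" for j
    unfolding b_def
    by (rule moment_recursion_bound) (use w d even_moment_1_le[OF \<alpha>] even_moment_recursion[OF \<alpha>] in \<open>simp_all add: even_moment_0 w_def d_def\<close>)
  have even: "even_moment k \<le> b k" for k
  proof -
    consider "k = 0" | "k = 1" | j where "k = Suc (Suc j)"
      by (metis One_nat_def not0_implies_Suc)
    then show ?thesis
    proof cases
      case 2
      then show ?thesis using even_moment_1_le[OF \<alpha>] by (simp add: b_def w_def d_def mult_ac)
    next
      case (3 j)
      then show ?thesis using strong[of j] b_nonneg[of k] by simp
    qed (simp add: even_moment_0 b_def d_def)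
  qed
  have "trace_moment n \<le> d * fact n * s ^ n"
  proof (cases "even n")
    case True
    then obtain k where k: "n = 2 * k" by (elim evenE)
    have "trace_moment n \<le> b k" unfolding k trace_moment_double by (rule even)
    also have "b k = d * fact n * s ^ n"
      by (simp add: b_def k power_mult s)
    finally show ?thesis .
  next
    case False
    then obtain k where k: "n = Suc (2 * k)" by (metis oddE Suc_eq_plus1)
    have sn: "(s ^ n)\<^sup>2 = (w / 2) ^ n"
      by (simp add: s power_mult[symmetric] mult.commute[of n 2]) (simp add: power_mult s)
    have "(trace_moment n)\<^sup>2 \<le> (d * fact n * s ^ n)\<^sup>2"
    \<comment> \<open>Interpolation requires 5 / 6 \<le> (2 k + 1) / (2 k + 2), which holds from k =
      2 on, with equality there. The third moment is handled by the centred estimate.\<close>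
    proof (cases "k = 1")
      case True
      have "(trace_moment n)\<^sup>2 \<le> even_moment 1 * (even_moment 2 - (norm (mean_pow 2))\<^sup>2)"
        using trace_moment_3_squared_le True by (simp add: k numeral_3_eq_3)
      also have "\<dots> \<le> (w * d) * (w * 4 * (w * d))"
      proof (rule mult_mono)
        show "even_moment 1 \<le> w * d" using even_moment_1_le[OF \<alpha>] by (simp add: w_def d_def)
        then have "w * 4 * even_moment 1 \<le> w * 4 * (w * d)" using w by (intro mult_left_mono) auto
        moreover have "even_moment 2 - (norm (mean_pow 2))\<^sup>2 \<le> w * 4 * even_moment 1"
          using variance_power_le[OF \<alpha>, of 1] by (simp add: w_def flip: numeral_2_eq_2)
        ultimately show "even_moment 2 - (norm (mean_pow 2))\<^sup>2 \<le> w * 4 * (w * d)" by (rule order_trans[rotated])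
      qed (use w d variance_nonneg in auto)
      also have "\<dots> = 4 * (d\<^sup>2 * w ^ 3)"
        by (simp add: power2_eq_square power3_eq_cube)
      \<comment> \<open>The constant 9 / 2 is the square of 3! divided by 2^3.\<close>
      also have "\<dots> \<le> 9 / 2 * (d\<^sup>2 * w ^ 3)"
        using w by (intro mult_right_mono) auto
      also have "\<dots> = (d * fact n * s ^ n)\<^sup>2"
        unfolding power_mult_distrib sn
        by (simp add: k True numeral_3_eq_3 power_divide)
      finally show ?thesis .
    next
      case False
      moreover have "k \<noteq> 0" using n k by auto
      ultimately obtain j where j: "k = Suc (Suc j)" by (metis One_nat_def not0_implies_Suc)
      have "(trace_moment n)\<^sup>2 \<le> even_moment k * even_moment (Suc k)"
        unfolding k by (rule trace_moment_odd_squared_le)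
      also have "\<dots> \<le> b k * (5 / 6 * b (Suc k))"
        using even[of k] strong[of "Suc j"] b_nonneg even_moment_nonneg by (intro mult_mono) (auto simp: j)
      also have "\<dots> = d\<^sup>2 * (w / 2) ^ n * (fact (2 * k))\<^sup>2 * (2 * real k + 1) * (5 / 6 * (2 * real k + 2))"
      proof -
        have 1: "(fact (2 * Suc k) :: real) = (2 * real k + 2) * ((2 * real k + 1) * fact (2 * k))"
          by (simp add: algebra_simps)
        have 2: "(w / 2) ^ n = (w / 2) ^ k * (w / 2) ^ Suc k"
          unfolding power_add[symmetric] by (simp add: k mult_2)
        show ?thesis unfolding b_def 1 2 by (simp only: power2_eq_square mult_ac)
      qed
      also have "\<dots> \<le> d\<^sup>2 * (w / 2) ^ n * (fact (2 * k))\<^sup>2 * (2 * real k + 1) * (2 * real k + 1)"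
        using w j by (intro mult_left_mono) auto
      also have "\<dots> = (d * fact n * s ^ n)\<^sup>2"
        unfolding power_mult_distrib sn by (simp add: k power2_eq_square algebra_simps)
      finally show ?thesis .
    qed
    then show ?thesis
      by (rule power2_le_imp_le) (use d s in simp)
  qed
  then show ?thesis by (simp add: d_def s_def w_def)
qed

text \<open>Squares of truncated exponential series stand in for \<open>exp (\<theta> g)\<close>, so that only moments are needed.\<close>

lemma tail_bound:
  assumes \<alpha>: "0 \<le> \<alpha>" and w: "0 < \<alpha> * v" and t: "0 \<le> t"
  shows "measure \<mu> {x \<in> space \<mu>. t \<le> lambda_max (g x)} \<le>
    real CARD('n) * exp (- (t\<^sup>2 / (2 * (\<alpha> * v) + t * sqrt (2 * (\<alpha> * v)))))"
proof -
  define d where "d = real CARD('n)"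
  define s where "s = sqrt (\<alpha> * v / 2)"
  define \<theta> where "\<theta> = t / (\<alpha> * v + t * s)"
  note bern = bernstein_exponent[OF w t, folded s_def, folded \<theta>_def]
  \<comment> \<open>Coefficients of the exponential of \<theta> r / 2; the half is undone by
    squaring.\<close>
  define c where "c i = (\<theta> / 2) ^ i / fact i" for i :: nat
  define q where "q N r = (\<Sum>i\<le>N. c i * r ^ i)" for N and r :: real
  define Q where "Q N x = (\<Sum>i\<le>N. c i *\<^sub>R matpow (g x) i)" for N x
  define B where "B = d * exp ((\<theta> * s)\<^sup>2 / (1 - \<theta> * s))"
  have c: "0 \<le> c i" for i using bern(1) by (simp add: c_def)
  have Q_sq: "(norm (Q N x))\<^sup>2 = (\<Sum>i\<le>N. \<Sum>j\<le>N. c i * c j * (matpow (g x) i \<bullet> matpow (g x) j))" for N x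
    by (simp add: Q_def power2_norm_eq_inner inner_sum_left inner_sum_right sum_distrib_left mult.assoc)
      (simp add: inner_commute)
  have Q_int: "integrable \<mu> (\<lambda>x. (norm (Q N x))\<^sup>2)" for N
    unfolding Q_sq by (intro Bochner_Integration.integrable_sum integrable_mult_right integrable_pow_inner)
  have Q_le: "(\<integral>x. (norm (Q N x))\<^sup>2 \<partial>\<mu>) \<le> B" for N
  proof -
    have "(\<integral>x. (norm (Q N x))\<^sup>2 \<partial>\<mu>) = (\<Sum>i\<le>N. \<Sum>j\<le>N. c i * c j * trace_moment (i + j))"
      unfolding Q_sq trace_moment_add using integrable_pow_inner by simp
    also have "\<dots> \<le> B"
      unfolding c_def B_def
      by (rule exp_polynomial_moment_bound)
        (use bern(1,2) w trace_moment_1 trace_moment_double[of 0] even_moment_0 moment_bound[OF \<alpha>] in \<open>auto simp: d_def s_def\<close>)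
    finally show ?thesis .
  qed
  have le: "measure \<mu> {x \<in> space \<mu>. t \<le> lambda_max (g x)} * (q N t)\<^sup>2 \<le> B" for N
  proof -
    have q_pos: "0 < q N t"
    proof -
      have "c 0 * t ^ 0 \<le> q N t"
        unfolding q_def by (rule member_le_sum) (use c t in auto)
      then show ?thesis by (simp add: c_def)
    qed
    \<comment> \<open>The larger event is defined by the measurable \<open>norm (Q N x)\<close>, so
      Markov's inequality applies without measurability of \<open>lambda_max\<close>.\<close>
    have sub: "{x \<in> space \<mu>. t \<le> lambda_max (g x)} \<subseteq> {x \<in> space \<mu>. (q N t)\<^sup>2 \<le> (norm (Q N x))\<^sup>2}"
    proof safe
      fix x assume "x \<in> space \<mu>" and le: "t \<le> lambda_max (g x)"
      obtain u where u: "u \<noteq> 0" "g x *v u = complex_of_real (lambda_max (g x)) *s u"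
        using lambda_max_eigenvector[OF herm] .
      \<comment> \<open>The coefficients are nonnegative and 0 \<le> t, so \<open>q N\<close> is
        monotone from t on.\<close>
      have "q N t \<le> q N (lambda_max (g x))"
        unfolding q_def using c t le by (intro sum_mono mult_left_mono power_mono) auto
      also have "\<dots> \<le> norm (Q N x)"
        using abs_polynomial_eigenvalue_le_norm[OF u, of c "{..N}"] by (simp add: q_def Q_def)
      finally show "(q N t)\<^sup>2 \<le> (norm (Q N x))\<^sup>2"
        using q_pos by (intro power_mono) auto
    qed
    note [measurable] = borel_measurable_integrable[OF Q_int]
    have "measure \<mu> {x \<in> space \<mu>. t \<le> lambda_max (g x)} \<le> measure \<mu> {x \<in> space \<mu>. (q N t)\<^sup>2 \<le> (norm (Q N x))\<^sup>2}"
      by (rule finite_measure_mono[OF sub]) measurable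
    also have "\<dots> \<le> (\<integral>x. (norm (Q N x))\<^sup>2 \<partial>\<mu>) / (q N t)\<^sup>2"
      using integral_Markov_inequality_measure[OF Q_int, where A = "space \<mu>" and c = "(q N t)\<^sup>2"] q_pos by simp
    also have "\<dots> \<le> B / (q N t)\<^sup>2"
      by (intro divide_right_mono Q_le) simp
    finally show ?thesis using q_pos by (simp add: pos_le_divide_eq)
  qed
  have "(\<theta> / 2 * t) ^ i /\<^sub>R fact i = c i * t ^ i" for i
    unfolding power_mult_distrib[of "\<theta> / 2" t] c_def real_scaleR_def divide_inverse[of "(\<theta> / 2) ^ i"]
    by (simp only: mult_ac)
  then have "(\<lambda>i. c i * t ^ i) sums exp (\<theta> / 2 * t)"
    using exp_converges[of "\<theta> / 2 * t"] by (simp only:)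
  then have "(\<lambda>N. q N t) \<longlonglongrightarrow> exp (\<theta> / 2 * t)"
    by (simp add: sums_def_le q_def)
  \<comment> \<open>Only the scalar \<open>q N t\<close> varies with N, so no limit is taken under
    an integral.\<close>
  then have "(\<lambda>N. measure \<mu> {x \<in> space \<mu>. t \<le> lambda_max (g x)} * (q N t)\<^sup>2) \<longlonglongrightarrow>
      measure \<mu> {x \<in> space \<mu>. t \<le> lambda_max (g x)} * (exp (\<theta> / 2 * t))\<^sup>2"
    by (intro tendsto_intros)
  then have "measure \<mu> {x \<in> space \<mu>. t \<le> lambda_max (g x)} * (exp (\<theta> / 2 * t))\<^sup>2 \<le> B"
    by (rule LIMSEQ_le_const2) (use le in blast)
  also have "(exp (\<theta> / 2 * t))\<^sup>2 = exp (\<theta> * t)"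
    by (simp add: exp_double[symmetric])
  finally have "measure \<mu> {x \<in> space \<mu>. t \<le> lambda_max (g x)} \<le> B / exp (\<theta> * t)"
    by (simp add: pos_le_divide_eq)
  also have "\<dots> = d * exp ((\<theta> * s)\<^sup>2 / (1 - \<theta> * s) - \<theta> * t)"
    by (simp add: B_def exp_diff)
  finally show ?thesis unfolding bern(3) d_def .
qed

end

section \<open>The concentration inequality\<close>

lemma function_algebra_sum:
  assumes "function_algebra A" "\<And>i. i \<in> I \<Longrightarrow> f i \<in> A"
  shows "(\<lambda>x. \<Sum>i\<in>I. f i x) \<in> A"
  using assms(2) by (induction I rule: infinite_finite_induct) (use assms(1) in \<open>auto simp: function_algebra_def\<close>)

lemma function_algebra_entries_mult:
  assumes "function_algebra A" "entries_in F A" "entries_in H A"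
  shows "entries_in (\<lambda>x. F x ** H x) A"
  using assms unfolding entries_in_def matrix_matrix_mult_def
  by (auto intro!: function_algebra_sum simp: function_algebra_def)

lemma function_algebra_entries_matpow:
  assumes "function_algebra A" "\<And>c. (\<lambda>_. c) \<in> A" "entries_in F A"
  shows "entries_in (\<lambda>x. matpow (F x) k) A"
proof (induction k)
  case 0
  show ?case using assms(2) by (simp add: entries_in_def)
next
  case (Suc k)
  then show ?case using function_algebra_entries_mult[OF assms(1,3)] by simp
qed

text \<open>Centring leaves the given algebra, which need not contain the constants.\<close>

definition adjoin_constants :: "('a \<Rightarrow> complex) set \<Rightarrow> ('a \<Rightarrow> complex) set" where
  "adjoin_constants A = {f. \<exists>h\<in>A. \<exists>c. \<forall>x. f x = h x + c}"

lemma function_algebra_adjoin_constants: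
  assumes "function_algebra A"
  shows "function_algebra (adjoin_constants A)"
proof -
  have A: "(\<lambda>x. 0) \<in> A" "\<And>f g. f \<in> A \<Longrightarrow> g \<in> A \<Longrightarrow> (\<lambda>x. f x + g x) \<in> A"
    "\<And>c f. f \<in> A \<Longrightarrow> (\<lambda>x. c * f x) \<in> A" "\<And>f g. f \<in> A \<Longrightarrow> g \<in> A \<Longrightarrow> (\<lambda>x. f x * g x) \<in> A"
    using assms by (auto simp: function_algebra_def)
  have I: "f \<in> adjoin_constants A" if "h \<in> A" "\<And>x. f x = h x + c" for f h c
    using that unfolding adjoin_constants_def by blast
  have add: "(\<lambda>x. f x + g x) \<in> adjoin_constants A" if fg: "f \<in> adjoin_constants A" "g \<in> adjoin_constants A" for f g
  proof -
    obtain h c k e where "\<And>x. f x = h x + c" "\<And>x. g x = k x + e" "h \<in> A" "k \<in> A"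
      using fg unfolding adjoin_constants_def by blast
    then show ?thesis by (intro I[of "\<lambda>x. h x + k x" _ "c + e"] A) auto
  qed
  have scale: "(\<lambda>x. b * f x) \<in> adjoin_constants A" if f: "f \<in> adjoin_constants A" for b f
  proof -
    obtain h c where "\<And>x. f x = h x + c" "h \<in> A"
      using f unfolding adjoin_constants_def by blast
    then show ?thesis by (intro I[of "\<lambda>x. b * h x" _ "b * c"] A) (auto simp: algebra_simps)
  qed
  have mult: "(\<lambda>x. f x * g x) \<in> adjoin_constants A" if fg: "f \<in> adjoin_constants A" "g \<in> adjoin_constants A" for f g
  proof -
    obtain h c k e where "\<And>x. f x = h x + c" "\<And>x. g x = k x + e" "h \<in> A" "k \<in> A"
      using fg unfolding adjoin_constants_def by blast
    then show ?thesis
      by (intro I[of "\<lambda>x. h x * k x + (e * h x + c * k x)" _ "c * e"] A) (auto simp: algebra_simps)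
  qed
  have "(\<lambda>x. 0) \<in> adjoin_constants A" by (rule I[OF A(1), of _ 0]) simp
  with add scale mult show ?thesis unfolding function_algebra_def by blast
qed

section \<open>Derivatives of centred matrix functions\<close>

context reversible_kernels
begin

lemma adjoin_constants_subset_gen_domain:
  assumes "A \<subseteq> gen_domain \<mu> P"
  shows "adjoin_constants A \<subseteq> gen_domain \<mu> P"
proof
  fix u assume "u \<in> adjoin_constants A"
  then obtain h c where u: "\<And>x. u x = h x + c" and "h \<in> A"
    unfolding adjoin_constants_def by blast
  then obtain h' where "generates \<mu> P h h'"
    using assms unfolding gen_domain_def by blast
  from generates_add[OF this generates_const[of c]] show "u \<in> gen_domain \<mu> P"
    unfolding u[symmetric] gen_domain_def by blast
qed

lemma mgenerates_const: "mgenerates (\<lambda>_. C) (\<lambda>_. 0)"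
  by (simp add: mgenerates_def generates_const)

lemma mgenerates_add: "mgenerates F F' \<Longrightarrow> mgenerates H H' \<Longrightarrow> mgenerates (\<lambda>x. F x + H x) (\<lambda>x. F' x + H' x)"
  by (simp add: mgenerates_def generates_add)

lemma mgenerates_diff: "mgenerates F F' \<Longrightarrow> mgenerates H H' \<Longrightarrow> mgenerates (\<lambda>x. F x - H x) (\<lambda>x. F' x - H' x)"
  by (simp add: mgenerates_def generates_diff)

lemma mgenerates_mult_const:
  assumes "mgenerates F F'"
  shows "mgenerates (\<lambda>x. C ** F x) (\<lambda>x. C ** F' x)" "mgenerates (\<lambda>x. F x ** C) (\<lambda>x. F' x ** C)"
  using assms unfolding mgenerates_def matrix_matrix_mult_def
  by (auto intro!: generates_sum generates_cmult simp: mult.commute[of _ "C $ _ $ _"])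

end

lemma reversible_kernels_markov_process:
  fixes \<mu> :: "'a::polish_space measure"
  assumes "prob_space \<mu>" and sets: "sets \<mu> = sets borel"
    and markov: "markov_process W Pr X" and stat: "stationary_measure \<mu> Pr X"
    and rev: "reversible \<mu> (markov_semigroup Pr X)"
  shows "reversible_kernels \<mu> (\<lambda>t x. distr (Pr x) borel (X t)) (markov_semigroup Pr X)"
proof -
  interpret prob_space \<mu> by fact
  have Pr: "Pr \<in> borel \<rightarrow>\<^sub>M prob_algebra W" and X: "X t \<in> W \<rightarrow>\<^sub>M borel" if "t \<ge> 0" for t
    using markov that by (auto simp: markov_process_def)
  show ?thesis
  proof
    fix t :: real assume t: "t \<ge> 0"
    have "(\<lambda>x. distr (Pr x) borel (X t)) \<in> borel \<rightarrow>\<^sub>M prob_algebra borel"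
      by (rule measurable_distr_prob_space2[OF Pr[OF t]]) (use X[OF t] in simp)
    then show "(\<lambda>x. distr (Pr x) borel (X t)) \<in> \<mu> \<rightarrow>\<^sub>M prob_algebra \<mu>"
      by (simp add: measurable_cong_sets[OF sets refl] prob_algebra_def subprob_algebra_cong[OF sets])
    show "\<mu> \<bind> (\<lambda>x. distr (Pr x) borel (X t)) = \<mu>"
      using stat t by (simp add: stationary_measure_def)
    fix f :: "'a \<Rightarrow> complex" and x assume f: "f \<in> borel_measurable \<mu>"
    have "sets (Pr x) = sets W"
      using measurable_space[OF Pr[OF t], of x] by (simp add: space_prob_algebra)
    then have "X t \<in> Pr x \<rightarrow>\<^sub>M borel"
      using X[OF t] by (simp cong: measurable_cong_sets)
    then show "markov_semigroup Pr X t f x = (\<integral>y. f y \<partial>distr (Pr x) borel (X t))"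
      using f by (simp add: markov_semigroup_def integral_distr measurable_cong_sets[OF sets refl])
  qed (rule rev)
qed

lemma exp_ereal_nonneg: "0 \<le> exp_ereal x"
  by (simp add: exp_ereal_def)

theorem theorem1p1:
  fixes \<mu> :: "'a::polish_space measure"
    and W :: "'w measure" and Pr :: "'a \<Rightarrow> 'w measure" and X :: "real \<Rightarrow> 'w \<Rightarrow> 'a"
    and P :: "real \<Rightarrow> ('a \<Rightarrow> complex) \<Rightarrow> 'a \<Rightarrow> complex"
    and \<alpha> t :: real
    and \<A> :: "('a \<Rightarrow> complex) set"
    and f :: "'a \<Rightarrow> complex^'n^'n"
    and v :: ereal
  assumes "prob_space \<mu>" and "sets \<mu> = sets borel"
    and "markov_process W Pr X" and "stationary_measure \<mu> Pr X"
    and "P = markov_semigroup Pr X"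
    and "reversible \<mu> P"
    and poincare: "\<And>F :: 'a \<Rightarrow> complex^'n^'n.
          (\<forall>x. hermitian (F x)) \<Longrightarrow> entries_in F (gen_domain \<mu> P) \<Longrightarrow>
          mvariance \<mu> F \<preceq> \<alpha> *\<^sub>R dirichlet_form \<mu> P F"
    and "function_algebra \<A>" and "\<A> \<subseteq> gen_domain \<mu> P"
    and "\<forall>x. hermitian (f x)" and "entries_in f \<A>"
    and "v = esssup_op_norm \<mu> (carre_du_champ \<mu> P f)"
    and "t \<ge> 0"
  shows "ereal (measure \<mu> {x \<in> space \<mu>. lambda_max (f x - mexpectation \<mu> f) \<ge> t})
    \<le> ereal (real CARD('n)) *
        exp_ereal (- (ereal (t\<^sup>2) /
          (ereal (2 * \<alpha>) * v + ereal t * sqrt_ereal (ereal (2 * \<alpha>) * v))))"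
proof -
  interpret reversible_kernels \<mu> "\<lambda>t x. distr (Pr x) borel (X t)" P
    using reversible_kernels_markov_process[OF assms(1-4)] assms(6) unfolding assms(5) .
  define C where "C = mexpectation \<mu> f"
  define g where "g x = f x - C" for x
  define \<G> where "\<G> x = mgenerator \<mu> P f x" for x
  \<comment> \<open>The derivative of \<open>g x ** g x\<close> read off from its expansion in f and
    C, where the constant \<open>C ** C\<close> contributes 0.\<close>
  define \<H> where "\<H> x = mgenerator \<mu> P (\<lambda>x. f x ** f x) x - C ** \<G> x - \<G> x ** C" for x
  let ?B = "adjoin_constants \<A>"
  have alg: "function_algebra ?B"
    by (rule function_algebra_adjoin_constants) fact
  have const: "(\<lambda>_. c) \<in> ?B" for c
    using assms(8) unfolding adjoin_constants_def function_algebra_def by force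
  have f_dom: "entries_in f (gen_domain \<mu> P)" and ff_dom: "entries_in (\<lambda>x. f x ** f x) (gen_domain \<mu> P)"
    using function_algebra_entries_mult[OF assms(8,11,11)] assms(9,11) by (auto simp: entries_in_def)
  have "entries_in g ?B"
    unfolding entries_in_def
  proof (intro allI)
    fix i j
    have "g x $ i $ j = f x $ i $ j + - (C $ i $ j)" for x by (simp add: g_def)
    moreover have "(\<lambda>x. f x $ i $ j) \<in> \<A>" using assms(11) by (simp add: entries_in_def)
    ultimately show "(\<lambda>x. g x $ i $ j) \<in> ?B"
      unfolding adjoin_constants_def mem_Collect_eq by (intro bexI exI allI)
  qed
  then have dom: "entries_in (\<lambda>x. matpow (g x) k) (gen_domain \<mu> P)" for k
    using function_algebra_entries_matpow[OF alg const, of g k] adjoin_constants_subset_gen_domain[OF assms(9)]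
    by (auto simp: entries_in_def)
  have gen: "mgenerates f \<G>" "mgenerates (\<lambda>x. f x ** f x) (mgenerator \<mu> P (\<lambda>x. f x ** f x))"
    using mgenerates_mgenerator[OF f_dom] mgenerates_mgenerator[OF ff_dom] by (simp_all add: \<G>_def[abs_def])
  have g_gen: "mgenerates g \<G>"
    using mgenerates_diff[OF gen(1) mgenerates_const[of C]] by (simp add: g_def[abs_def])
  have gg: "g x ** g x = f x ** f x - C ** f x - f x ** C + C ** C" for x
    by (simp add: g_def matrix_diff_ldistrib matrix_diff_rdistrib)
  have gg_gen: "mgenerates (\<lambda>x. g x ** g x) \<H>"
    using mgenerates_add[OF mgenerates_diff[OF mgenerates_diff[OF gen(2) mgenerates_mult_const(1)[OF gen(1), of C]]
        mgenerates_mult_const(2)[OF gen(1), of C]] mgenerates_const[of "C ** C"]]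
    by (simp add: gg \<H>_def[abs_def])
  \<comment> \<open>The terms containing C cancel: centring does not change the carre du champ, not
    even on a null set.\<close>
  have carre_eq: "(1 / 2) *\<^sub>R (\<H> x - g x ** \<G> x - \<G> x ** g x) = carre_du_champ \<mu> P f x" for x
    by (simp add: carre_du_champ_def g_def \<G>_def \<H>_def matrix_diff_ldistrib matrix_diff_rdistrib)
  have f_int: "integrable \<mu> (\<lambda>x. f x $ i $ j)" for i j
    using mgenerates_L2(1)[OF gen(1)] L2_integrable by (auto simp: entries_in_def)
  have herm: "hermitian (g x)" for x
    unfolding g_def C_def using assms(10) by (intro hermitian_diff hermitian_mexpectation) auto
  have mean: "mexpectation \<mu> g = 0"
    using f_int by (simp add: vec_eq_iff mexpectation_def g_def C_def prob_space)
  interpret poincare_powers \<mu> "\<lambda>t x. distr (Pr x) borel (X t)" P g \<alpha>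
    by unfold_locales (use herm dom mean poincare in auto)
  define p where "p = measure \<mu> {x \<in> space \<mu>. lambda_max (f x - mexpectation \<mu> f) \<ge> t}"
  have p: "p = measure \<mu> {x \<in> space \<mu>. t \<le> lambda_max (g x)}"
    by (simp add: p_def g_def C_def)
  let ?E = "ereal (t\<^sup>2) / (ereal (2 * \<alpha>) * v + ereal t * sqrt_ereal (ereal (2 * \<alpha>) * v))"
  have card: "1 \<le> real CARD('n)"
    by (simp add: Suc_leI)
  \<comment> \<open>A vanishing quotient makes the right side equal to d, which is at least 1. This
    covers t = 0 and an infinite v.\<close>
  have trivial: ?thesis if "?E = 0"
    using order_trans[OF prob_le_1 card] unfolding that by (simp add: exp_ereal_def)
  have zero: ?thesis if "p = 0"
    using that exp_ereal_nonneg[of "- ?E"] unfolding p_def by (simp add: zero_ereal_def[symmetric])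
  have AE_v: "AE x in \<mu>. ereal (op_norm (carre_du_champ \<mu> P f x)) \<le> v"
    unfolding assms(12) esssup_op_norm_def by (rule esssup_AE)
  have v_pos: "0 \<le> v"
  proof -
    have "AE x in \<mu>. 0 \<le> v"
      using AE_v
    proof eventually_elim
      case (elim x)
      have "0 \<le> ereal (op_norm (carre_du_champ \<mu> P f x))" by (simp add: op_norm_nonneg)
      then show ?case using elim by (rule order_trans)
    qed
    then show ?thesis by (simp add: AE_const)
  qed
  \<comment> \<open>For \<alpha> \<le> 0 the denominator may involve the root of a negative number.
    There the probability is shown to be 0, and the right side only has to be nonnegative.\<close>
  consider "t = 0" | "0 < t" "\<alpha> \<le> 0" | "0 < t" "0 < \<alpha>" "v = \<infinity>" | r where "0 < t" "0 < \<alpha>" "v = ereal r"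
    using assms(13) v_pos by (cases v; cases "t = 0"; cases "\<alpha> \<le> 0") (simp_all add: less_le not_le)
  then show ?thesis
  proof cases
    case 1
    then show ?thesis by (intro trivial) (simp add: zero_ereal_def[symmetric])
  next
    case 2
    then show ?thesis using degenerate_tail[OF even_moment_1_nonpos] by (intro zero) (simp add: p)
  next
    case 3
    then show ?thesis by (intro trivial) (simp add: sqrt_ereal_def)
  next
    case (4 r)
    interpret poincare_bounded_carre \<mu> "\<lambda>t x. distr (Pr x) borel (X t)" P g \<alpha> \<G> \<H> r
      by unfold_locales (use g_gen gg_gen AE_v 4 in \<open>simp_all add: carre_eq\<close>)
    have r: "0 \<le> r" by (rule v_nonneg)
    show ?thesis
    proof (cases "r = 0")
      \<comment> \<open>Here the quotient is infinite and the right side is 0, so the probability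
        itself must vanish; it does because the second moment does.\<close>
      case True
      then have "p = 0"
        unfolding p using 4 even_moment_1_le by (intro degenerate_tail) auto
      then show ?thesis by (rule zero)
    next
      case False
      with r 4 have w: "0 < \<alpha> * r" by simp
      have "p \<le> real CARD('n) * exp (- (t\<^sup>2 / (2 * (\<alpha> * r) + t * sqrt (2 * (\<alpha> * r)))))"
        unfolding p using tail_bound[OF _ w] 4 by simp
      moreover have "0 < 2 * (\<alpha> * r) + t * sqrt (2 * (\<alpha> * r))"
        using w 4 by (intro add_pos_pos) auto
      ultimately show ?thesis
        unfolding p_def[symmetric] using 4 by (simp add: sqrt_ereal_def exp_ereal_def mult.assoc)
    qed
  qed
qed

end
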